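(* Let $n\ge 1$ and $T\ge 1$ be integers, let $\mathbf{W},\mathbf{Z}\in\mathbf{R}^{n\times n}$ be symmetric positive definite and let $\mathcal{L}_e\in\mathbf{R}^{n\times n}$ be symmetric positive semidefinite. Consider the problem of minimizing $$\sum_{t=1}^T\left(\operatorname{tr}(\mathbf{W}\mathcal{I}_t^{-1})+\operatorname{tr}(\mathbf{Z}^{-1}\mathcal{L}_{w,t})\right),\qquad \mathcal{I}_t=t\mathcal{L}_e+\sum_{k=1}^t\mathcal{L}_{w,k},$$ over all symmetric matrices $\mathcal{L}_{w,1},\dots,\mathcal{L}_{w,T}\in\mathbf{R}^{n\times n}$ with $\mathcal{L}_{w,t}\succeq 0$ for all $t=1,\dots,T$ and $\mathcal{L}_{w,1}+\mathcal{L}_e\succ 0$. Let $R(T)$ denote the optimal value. Let $\mathbf{V}$ be the unique positive definite square root of $\mathbf{Z}^{-1}$, so that $\mathbf{Z}^{-1}=\mathbf{V}\mathbf{V}$. When $\mathcal{L}_e\succ 0$, define $$c_T=\left(\lambda_{\max}\left(\mathbf{Z}\mathcal{L}_e^{-1}\mathbf{W}\mathcal{L}_e^{-1}\right)\sum_{t=1}^T\frac{1}{t^2}\right)^{-1}.$$ Then the optimal solution is of one of the following two types: Solution 1: $\mathcal{L}_{w,t}=0$ for all $t\ge 1$. Solution 2: $\mathcal{L}_{w,1}\neq 0$ and $\mathcal{L}_{w,t}=0$ for all $t\ge 2$. More precisely: Case 1: if $\mathcal{L}_e\succ 0$ and $c_T\ge 1$, then Solution 1 is optimal and $$R(T)=\operatorname{tr}(\mathcal{L}_e^{-1}\mathbf{W})\sum_{t=1}^T\frac1t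 .$$ Case 2: if $\mathcal{L}_e\succ 0$ and $c_T<1$, then a solution of the type Solution 2 is optimal and $$(2-c_T)\,c_T\operatorname{tr}(\mathcal{L}_e^{-1}\mathbf{W})\sum_{t=1}^T\frac1t\;\le\; R(T)\;\le\;\operatorname{tr}(\mathcal{L}_e^{-1}\mathbf{W})\sum_{t=1}^T\frac1t .$$ Case 3: if $\mathcal{L}_e$ is singular, then a solution of the type Solution 2 is optimal and $$\delta\sqrt{T}\;\le\; R(T)\;\le\;\chi\sqrt{T}+\nu_T,$$ where, with $S_{\mathbf{V}}=\mathbf{V}\mathcal{L}_e\mathbf{V}$, $W_{\mathbf{V}}=\mathbf{V}\mathbf{W}\mathbf{V}$, $\tilde W_{\mathbf{V}}$ the positive semidefinite square root of $W_{\mathbf{V}}$, $\{n_k\}_{k=1}^m$ any orthonormal basis of the null space of $S_{\mathbf{V}}$, and $S_{\mathbf{V}}=\sum_k\lambda_k e_ke_k^\top$ the eigendecomposition of $S_{\mathbf{V}}$ with orthonormal eigenvectors $e_k$ and the sum running over the nonzero eigenvalues $\lambda_k$, $$\delta=2\sum_{k=1}^m n_k^\top\tilde W_{\mathbf{V}}n_k,\qquad \chi=\sum_{k=1}^m\frac{n_k^\top W_{\mathbf{V}}n_k}{n_k^\top\tilde W_{\mathbf{V}}n_k}+\sum_{k=1}^m n_k^\top\tilde W_{\mathbf{V}}n_k,\qquad \nu_T=\left(\sum_{t=1}^T\frac1t\right)\sum_k\frac{e_k^\top W_{\mathbf{V}}e_k}{\lambda_k}.$$ Here $\delta$ and $\chi$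 are positive and do not depend on $T$, and $\nu_T=o(\sqrt T)$ as $T\to\infty$.
   Context: For a real symmetric matrix $A$, $A\succ 0$ means positive definite and $A\succeq 0$ means positive semidefinite. $\operatorname{tr}$ is the trace and $\lambda_{\max}(A)$ is the largest eigenvalue of $A$ (the product $\mathbf{Z}\mathcal{L}_e^{-1}\mathbf{W}\mathcal{L}_e^{-1}$ is similar to a symmetric matrix, so its eigenvalues are real). In the application, $\mathcal{I}_t$ is the Fisher information matrix at time $t$, $\mathcal{L}_{w,t}$ is the information contributed at time $t$ by external excitation (the decision variable), $\mathcal{L}_e$ is the time-invariant information contributed by the noise, and $R(T)$ is the modeled cumulative regret. *)

theory Defs
  imports "HOL-Analysis.Analysis" "HOL-Library.Landau_Symbols"
begin

text \<open>Both definiteness predicates include symmetry of the matrix.\<close>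

definition pos_semidef :: "real^'n^'n \<Rightarrow> bool" where
  "pos_semidef A \<longleftrightarrow> transpose A = A \<and> (\<forall>x. 0 \<le> x \<bullet> (A *v x))"

definition pos_def :: "real^'n^'n \<Rightarrow> bool" where
  "pos_def A \<longleftrightarrow> transpose A = A \<and> (\<forall>x. x \<noteq> 0 \<longrightarrow> 0 < x \<bullet> (A *v x))"

definition psd_sqrt :: "real^'n^'n \<Rightarrow> real^'n^'n" where
  "psd_sqrt A = (THE B. pos_semidef B \<and> B ** B = A)"

definition pd_sqrt :: "real^'n^'n \<Rightarrow> real^'n^'n" where
  "pd_sqrt A = (THE B. pos_def B \<and> B ** B = A)"

text \<open>The largest real eigenvalue; it is only used for matrices that are similar to a symmetric
  matrix, so that all eigenvalues are real and there is at least one.\<close>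

definition eigenvalues :: "real^'n^'n \<Rightarrow> real set" where
  "eigenvalues A = {\<mu>. \<exists>v. v \<noteq> 0 \<and> A *v v = \<mu> *\<^sub>R v}"

definition lambda_max :: "real^'n^'n \<Rightarrow> real" where
  "lambda_max A = Max (eigenvalues A)"

definition fisher_info :: "real^'n^'n \<Rightarrow> (nat \<Rightarrow> real^'n^'n) \<Rightarrow> nat \<Rightarrow> real^'n^'n" where
  "fisher_info Le L t = real t *\<^sub>R Le + (\<Sum>k=1..t. L k)"

definition cost ::
  "real^'n^'n \<Rightarrow> real^'n^'n \<Rightarrow> real^'n^'n \<Rightarrow> nat \<Rightarrow> (nat \<Rightarrow> real^'n^'n) \<Rightarrow> real" where
  "cost W Z Le T L =
     (\<Sum>t=1..T. trace (W ** matrix_inv (fisher_info Le L t)) + trace (matrix_inv Z ** L t))"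

text \<open>A decision variable is a function on all of \<^typ>\<open>nat\<close>, of which only the values on
  \<open>{1..T}\<close> are meaningful; all notions below depend on these values only (for \<open>T \<ge> 1\<close>).\<close>

definition feasible :: "real^'n^'n \<Rightarrow> nat \<Rightarrow> (nat \<Rightarrow> real^'n^'n) \<Rightarrow> bool" where
  "feasible Le T L \<longleftrightarrow> (\<forall>t\<in>{1..T}. pos_semidef (L t)) \<and> pos_def (L 1 + Le)"

definition optimal ::
  "real^'n^'n \<Rightarrow> real^'n^'n \<Rightarrow> real^'n^'n \<Rightarrow> nat \<Rightarrow> (nat \<Rightarrow> real^'n^'n) \<Rightarrow> bool" where
  "optimal W Z Le T L \<longleftrightarrow>
     feasible Le T L \<and> (\<forall>L'. feasible Le T L' \<longrightarrow> cost W Z Le T L \<le> cost W Z Le T L')"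

definition regret :: "real^'n^'n \<Rightarrow> real^'n^'n \<Rightarrow> real^'n^'n \<Rightarrow> nat \<Rightarrow> real" where
  "regret W Z Le T = (INF L\<in>{L. feasible Le T L}. cost W Z Le T L)"

definition solution1 :: "nat \<Rightarrow> (nat \<Rightarrow> real^'n^'n) \<Rightarrow> bool" where
  "solution1 T L \<longleftrightarrow> (\<forall>t\<in>{1..T}. L t = 0)"

definition solution2 :: "nat \<Rightarrow> (nat \<Rightarrow> real^'n^'n) \<Rightarrow> bool" where
  "solution2 T L \<longleftrightarrow> L 1 \<noteq> 0 \<and> (\<forall>t\<in>{2..T}. L t = 0)"

definition c_const :: "real^'n^'n \<Rightarrow> real^'n^'n \<Rightarrow> real^'n^'n \<Rightarrow> nat \<Rightarrow> real" where
  "c_const W Z Le T =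
     inverse (lambda_max (Z ** matrix_inv Le ** W ** matrix_inv Le) * (\<Sum>t=1..T. 1 / (real t)\<^sup>2))"

definition S_V :: "real^'n^'n \<Rightarrow> real^'n^'n \<Rightarrow> real^'n^'n" where
  "S_V V Le = V ** Le ** V"

definition W_V :: "real^'n^'n \<Rightarrow> real^'n^'n \<Rightarrow> real^'n^'n" where
  "W_V V W = V ** W ** V"

definition orthonormal_family :: "nat \<Rightarrow> (nat \<Rightarrow> real^'n) \<Rightarrow> bool" where
  "orthonormal_family m v \<longleftrightarrow>
     (\<forall>i\<in>{1..m}. \<forall>j\<in>{1..m}. v i \<bullet> v j = (if i = j then 1 else 0))"

definition orthonormal_null_basis :: "real^'n^'n \<Rightarrow> nat \<Rightarrow> (nat \<Rightarrow> real^'n) \<Rightarrow> bool" where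
  "orthonormal_null_basis S m v \<longleftrightarrow>
     orthonormal_family m v \<and> span (v ` {1..m}) = {x. S *v x = 0}"

definition outer_self :: "real^'n \<Rightarrow> real^'n^'n" where
  "outer_self v = (\<chi> i j. v $ i * v $ j)"

text \<open>The decomposition \<open>S = \<Sum>k. ev\<^sub>k e\<^sub>k e\<^sub>k\<^sup>T\<close> over the nonzero eigenvalues, counted with multiplicity;
  that the \<open>e\<^sub>k\<close> are eigenvectors for \<open>ev\<^sub>k\<close> follows from orthonormality.\<close>

definition eigendecomposition ::
  "real^'n^'n \<Rightarrow> nat \<Rightarrow> (nat \<Rightarrow> real) \<Rightarrow> (nat \<Rightarrow> real^'n) \<Rightarrow> bool" where
  "eigendecomposition S r ev e \<longleftrightarrow>
     orthonormal_family r e \<and> (\<forall>k\<in>{1..r}. ev k \<noteq> 0) \<and>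
     S = (\<Sum>k=1..r. ev k *\<^sub>R outer_self (e k))"

text \<open>In the next three definitions the argument \<open>WV\<close> stands for the matrix \<^term>\<open>W_V V W\<close>.\<close>

definition delta_const :: "real^'n^'n \<Rightarrow> nat \<Rightarrow> (nat \<Rightarrow> real^'n) \<Rightarrow> real" where
  "delta_const WV m v = 2 * (\<Sum>k=1..m. v k \<bullet> (psd_sqrt WV *v v k))"

definition chi_const :: "real^'n^'n \<Rightarrow> nat \<Rightarrow> (nat \<Rightarrow> real^'n) \<Rightarrow> real" where
  "chi_const WV m v =
     (\<Sum>k=1..m. (v k \<bullet> (WV *v v k)) / (v k \<bullet> (psd_sqrt WV *v v k))) +
     (\<Sum>k=1..m. v k \<bullet> (psd_sqrt WV *v v k))"

definition nu_seq ::
  "real^'n^'n \<Rightarrow> nat \<Rightarrow> (nat \<Rightarrow> real) \<Rightarrow> (nat \<Rightarrow> real^'n) \<Rightarrow> nat \<Rightarrow> real" where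
  "nu_seq WV r ev e T =
     (\<Sum>t=1..T. 1 / real t) * (\<Sum>k=1..r. (e k \<bullet> (WV *v e k)) / ev k)"

end

theory Submission
  imports Defs "HOL-Real_Asymp.Real_Asymp"
begin

text \<open>
  Everything rests on one inequality. For symmetric positive definite \<open>B\<close>, positive definite \<open>W\<close> and an
  arbitrary square matrix \<open>P\<close>, expanding the positive semidefinite matrix
  \<open>(B\<^sup>-\<^sup>1 - P)\<^sup>T B (B\<^sup>-\<^sup>1 - P)\<close> gives
  \<open>tr (W B\<^sup>-\<^sup>1) \<ge> 2 tr (W P) - tr (P W P\<^sup>T B)\<close>, with equality only for \<open>P = B\<^sup>-\<^sup>1\<close>
  (\<open>inverse_minorant_le\<close>, \<open>inverse_minorant_eq_iff\<close>). The right-hand side is affine in \<open>B\<close>, so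
  \<open>B \<mapsto> tr (W B\<^sup>-\<^sup>1)\<close> is a supremum of affine functions: it is convex and lower semicontinuous, it
  decreases strictly in the Loewner order, and every choice of \<open>P\<close> yields a lower bound on the
  regret.

  Replacing a schedule by the one that injects the whole sum \<open>X = L\<^sub>1 + \<dots> + L\<^sub>T\<close> at the first step
  leaves the price \<open>tr (Z\<^sup>-\<^sup>1 X)\<close> unchanged and can only enlarge every information matrix, strictly
  so unless the schedule had this form already (\<open>cost_ge_static_cost\<close>). The problem therefore
  becomes the minimization of
  \<open>\<Sum>t\<le>T. tr (W (t L\<^sub>e + X)\<^sup>-\<^sup>1) + tr (Z\<^sup>-\<^sup>1 X)\<close> over one matrix \<open>X\<close>. A minimizing sequence is
  bounded because of the price, its limit points stay in the feasible set because the first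
  summand blows up at singular matrices, and strict convexity makes the minimizer unique
  (\<open>static_optimal_exists\<close>, \<open>static_optimal_unique\<close>). The optimal schedule is of the first type if
  \<open>X = 0\<close> and of the second type otherwise.

  If \<open>L\<^sub>e\<close> is positive definite, the choice \<open>P\<^sub>t = (c / t) L\<^sub>e\<^sup>-\<^sup>1\<close> bounds the cost below by \<open>(2 - c) c\<close>
  times its value at \<open>X = 0\<close> as soon as \<open>Z\<^sup>-\<^sup>1 - c\<^sup>2 (\<Sum>t\<le>T. 1/t\<^sup>2) L\<^sub>e\<^sup>-\<^sup>1 W L\<^sub>e\<^sup>-\<^sup>1\<close> is positive
  semidefinite, which is a condition on \<open>\<lambda>\<^sub>m\<^sub>a\<^sub>x\<close> (\<open>static_cost_ge_scaled\<close>). With \<open>c = 1\<close> this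
  shows that \<open>X = 0\<close> is optimal when \<open>c\<^sub>T \<ge> 1\<close>, and with \<open>c = c\<^sub>T\<close> it is the lower bound for
  \<open>c\<^sub>T < 1\<close>. In the latter case \<open>X = 0\<close> is not optimal, since a small multiple of \<open>v v\<^sup>T\<close> for a top
  eigenvector \<open>v\<close> decreases the cost (\<open>static_optimal_zero_imp\<close>).

  If \<open>L\<^sub>e\<close> is singular, the congruence with \<open>V\<close> turns \<open>Z\<close> into the identity. Choosing \<open>P\<close>
  supported on the null space of \<open>S\<^sub>V\<close> makes the bound independent of \<open>t\<close> and yields \<open>\<delta> \<surd>T\<close>
  (\<open>static_cost_ge_delta\<close>). The upper bound is the exact cost of an \<open>X\<close> that is diagonal in the given
  eigenbasis and of size \<open>\<surd>T\<close> on the null space (\<open>static_cost_le_chi_nu\<close>).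
\<close>

section \<open>Matrix algebra and definiteness\<close>

lemma matrix_diff_ldistrib: "A ** (B - C) = A ** B - A ** C"
  for A B C :: "real^'n^'n"
  by (simp add: matrix_matrix_mult_def vec_eq_iff sum_subtractf algebra_simps)

lemma matrix_diff_rdistrib: "(B - C) ** A = B ** A - C ** A"
  for A B C :: "real^'n^'n"
  by (simp add: matrix_matrix_mult_def vec_eq_iff sum_subtractf algebra_simps)

lemma matrix_add_rdistrib: "(B + C) ** A = B ** A + C ** A"
  for A B C :: "real^'n^'n"
  by (simp add: matrix_matrix_mult_def vec_eq_iff sum.distrib algebra_simps)

lemma matrix_scaleR_left: "(c *\<^sub>R A) ** B = c *\<^sub>R (A ** B)"
  for A B :: "real^'n^'n"
  by (simp add: matrix_matrix_mult_def vec_eq_iff sum_distrib_left mult.assoc)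

lemma matrix_scaleR_right: "A ** (c *\<^sub>R B) = c *\<^sub>R (A ** B)"
  for A B :: "real^'n^'n"
  by (simp add: matrix_matrix_mult_def vec_eq_iff sum_distrib_left algebra_simps)

lemma matrix_mult_zero_left [simp]: "(0 :: real^'n^'n) ** A = 0"
  and matrix_mult_zero_right [simp]: "A ** (0 :: real^'n^'n) = 0"
  by (simp_all add: matrix_matrix_mult_def vec_eq_iff)

lemma matrix_sum_right: "B ** (\<Sum>k\<in>S. f k) = (\<Sum>k\<in>S. B ** f k)"
  for f :: "_ \<Rightarrow> real^'n^'n" and B :: "real^'n^'n"
  by (induction S rule: infinite_finite_induct)
    (simp_all add: matrix_add_ldistrib)

lemma matrix_vector_scaleR_left: "(c *\<^sub>R A) *v x = c *\<^sub>R (A *v x)"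
  for A :: "real^'n^'n"
  by (simp add: scaleR_matrix_vector_assoc)

lemma matrix_vector_sum_left: "(\<Sum>k\<in>S. f k) *v x = (\<Sum>k\<in>S. f k *v x)"
  for x :: "real^'n"
  by (induction S rule: infinite_finite_induct)
    (simp_all add: matrix_vector_mult_add_rdistrib)

lemma transpose_add: "transpose (A + B) = transpose A + transpose B"
  for A B :: "real^'n^'n"
  by (simp add: transpose_def vec_eq_iff)

lemma transpose_diff: "transpose (A - B) = transpose A - transpose B"
  for A B :: "real^'n^'n"
  by (simp add: transpose_def vec_eq_iff)

lemma transpose_sum: "transpose (\<Sum>k\<in>S. f k) = (\<Sum>k\<in>S. transpose (f k))"
  for f :: "_ \<Rightarrow> real^'n^'n"
  by (simp add: transpose_def vec_eq_iff)

lemma transpose_zero: "transpose (0 :: real^'n^'n) = 0"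
  by (simp add: transpose_def vec_eq_iff)

lemma trace_scaleR: "trace (c *\<^sub>R A) = c * trace A"
  for A :: "real^'n^'n"
  by (simp add: trace_def sum_distrib_left)

lemma trace_sum: "trace (\<Sum>k\<in>S. f k) = (\<Sum>k\<in>S. trace (f k))"
  for f :: "_ \<Rightarrow> real^'n^'n"
  by (simp add: trace_def sum.swap[of _ UNIV S])

lemma trace_zero: "trace (0 :: real^'n^'n) = 0"
  by (simp add: trace_def)

lemma trace_transpose: "trace (transpose A) = trace A"
  for A :: "real^'n^'n"
  by (simp add: trace_def transpose_def)

lemma dot_matrix_transpose: "x \<bullet> (A *v y) = (transpose A *v x) \<bullet> y"
  for A :: "real^'n^'m"
  by (simp add: dot_lmul_matrix)

lemma dot_symmetric_matrix: "transpose A = A \<Longrightarrow> x \<bullet> (A *v y) = y \<bullet> (A *v x)"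
  for A :: "real^'n^'n"
  by (metis dot_matrix_transpose inner_commute)

lemma matrix_inv_unique:
  fixes A B :: "real^'n^'n"
  assumes "A ** B = mat 1"
  shows "matrix_inv A = B"
proof -
  have "A ** B = mat 1 \<and> B ** A = mat 1"
    using assms matrix_left_right_inverse by blast
  then have "A ** matrix_inv A = mat 1 \<and> matrix_inv A ** A = mat 1"
    unfolding matrix_inv_def by (rule someI)
  then show ?thesis
    by (metis assms matrix_mul_assoc matrix_mul_lid matrix_mul_rid)
qed

lemma quadratic_form_congruence:
  "x \<bullet> ((transpose C ** A ** C) *v x) = (C *v x) \<bullet> (A *v (C *v x))"
  for A :: "real^'n^'n" and C :: "real^'m^'n"
proof -
  have "x \<bullet> ((transpose C ** A ** C) *v x) = x \<bullet> (transpose C *v (A *v (C *v x)))"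
    by (simp add: matrix_vector_mul_assoc matrix_mul_assoc del: transpose_matrix_vector)
  also have "\<dots> = (C *v x) \<bullet> (A *v (C *v x))"
    by (subst dot_matrix_transpose) simp
  finally show ?thesis .
qed

lemma pos_def_imp_pos_semidef: "pos_def A \<Longrightarrow> pos_semidef A"
  unfolding pos_def_def pos_semidef_def by (metis inner_zero_left order_less_imp_le order_refl)

lemma pos_semidef_add: "pos_semidef A \<Longrightarrow> pos_semidef B \<Longrightarrow> pos_semidef (A + B)"
  by (simp add: pos_semidef_def transpose_add matrix_vector_mult_add_rdistrib inner_add_right)

lemma pos_def_add_pos_semidef: "pos_def A \<Longrightarrow> pos_semidef B \<Longrightarrow> pos_def (A + B)"
  by (simp add: pos_semidef_def pos_def_def transpose_add matrix_vector_mult_add_rdistrib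
      inner_add_right add_pos_nonneg)

lemma pos_semidef_scaleR: "0 \<le> c \<Longrightarrow> pos_semidef A \<Longrightarrow> pos_semidef (c *\<^sub>R A)"
  by (simp add: pos_semidef_def transpose_scalar matrix_vector_scaleR_left)

lemma pos_def_scaleR: "0 < c \<Longrightarrow> pos_def A \<Longrightarrow> pos_def (c *\<^sub>R A)"
  by (simp add: pos_def_def transpose_scalar matrix_vector_scaleR_left)

lemma pos_semidef_zero: "pos_semidef 0"
  by (simp add: pos_semidef_def transpose_zero)

lemma pos_semidef_sum: "(\<And>k. k \<in> S \<Longrightarrow> pos_semidef (f k)) \<Longrightarrow> pos_semidef (\<Sum>k\<in>S. f k)"
  by (induction S rule: infinite_finite_induct) (simp_all add: pos_semidef_zero pos_semidef_add)

lemma pos_def_mat_1: "pos_def (mat 1)"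
  by (simp add: pos_def_def)

lemma pos_semidef_congruence:
  "pos_semidef A \<Longrightarrow> pos_semidef (transpose C ** A ** C)"
  by (simp add: pos_semidef_def quadratic_form_congruence matrix_transpose_mul matrix_mul_assoc)

lemma pos_def_congruence:
  assumes "pos_def A" and "\<And>x. C *v x = 0 \<Longrightarrow> x = 0"
  shows "pos_def (transpose C ** A ** C)"
  using assms
  by (auto simp: pos_def_def quadratic_form_congruence matrix_transpose_mul matrix_mul_assoc)

lemma pos_def_inverse:
  assumes "pos_def A"
  shows "A ** matrix_inv A = mat 1" and "matrix_inv A ** A = mat 1"
proof -
  have "A *v x = 0 \<Longrightarrow> x = 0" for x
    using assms unfolding pos_def_def by (metis inner_zero_right less_irrefl)
  then obtain B where B: "B ** A = mat 1"
    using matrix_left_invertible_ker by blast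
  then have "A ** B = mat 1" using matrix_left_right_inverse by blast
  with B show "A ** matrix_inv A = mat 1" "matrix_inv A ** A = mat 1"
    using matrix_inv_unique by metis+
qed

lemma pos_def_inverse_mult:
  assumes "pos_def A"
  shows "A *v (matrix_inv A *v x) = x" and "matrix_inv A *v (A *v x) = x"
  by (simp_all add: matrix_vector_mul_assoc pos_def_inverse[OF assms])

lemma pos_def_kernel: "pos_def A \<Longrightarrow> A *v x = 0 \<Longrightarrow> x = 0"
  using pos_def_inverse_mult(2) matrix_vector_mult_0_right by metis

lemma pos_def_matrix_inv:
  assumes "pos_def A"
  shows "pos_def (matrix_inv A)"
proof -
  let ?B = "matrix_inv A"
  have A: "transpose A = A" using assms by (simp add: pos_def_def)
  have "transpose (?B ** A) = mat 1" by (simp add: pos_def_inverse[OF assms])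
  then have "A ** transpose ?B = mat 1" by (simp add: matrix_transpose_mul A)
  then have "transpose ?B = ?B" by (metis matrix_inv_unique)
  moreover have "0 < x \<bullet> (?B *v x)" if "x \<noteq> 0" for x
  proof -
    have "?B *v x \<noteq> 0" using that pos_def_inverse_mult(1)[OF assms, of x] by auto
    then have "0 < (?B *v x) \<bullet> (A *v (?B *v x))" using assms by (simp add: pos_def_def)
    then show ?thesis by (simp add: pos_def_inverse_mult[OF assms] inner_commute)
  qed
  ultimately show ?thesis by (simp add: pos_def_def)
qed

lemma pos_def_symmetric_congruence:
  assumes "pos_def A" and "pos_def C"
  shows "pos_def (C ** A ** C)"
proof -
  have "pos_def (transpose C ** A ** C)"
    by (rule pos_def_congruence[OF assms(1) pos_def_kernel[OF assms(2)]])
  then show ?thesis using assms(2) by (simp add: pos_def_def)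
qed

lemma linear_coefficient_zero:
  fixes a b :: real
  assumes "\<And>s. 0 \<le> 2 * s * b + s\<^sup>2 * a"
  shows "b = 0"
proof (rule ccontr)
  assume "b \<noteq> 0"
  define t where "t = \<bar>a\<bar> + 1"
  have t: "0 < t" "a \<le> t" by (simp_all add: t_def)
  \<comment> \<open>Any slope \<open>t\<close> with \<open>t \<ge> a\<close> and \<open>t > 0\<close> would do: \<open>s = - b / t\<close> minimizes \<open>2 s b + s\<^sup>2 t\<close>.\<close>
  let ?s = "- b / t"
  have "2 * ?s * b + ?s\<^sup>2 * a \<le> 2 * ?s * b + ?s\<^sup>2 * t"
    by (intro add_left_mono mult_left_mono t) auto
  also have "\<dots> = - (b\<^sup>2 / t)"
    using t by (simp add: field_simps power2_eq_square)
  also have "\<dots> < 0"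
    using \<open>b \<noteq> 0\<close> t by simp
  finally show False using assms[of ?s] by simp
qed

text \<open>A form that is nonnegative on a subspace and vanishes at \<open>v\<close> has a minimum there, so its
  derivative at \<open>v\<close> along the subspace is zero.\<close>

lemma symmetric_form_minimizer:
  fixes H :: "real^'n^'n"
  assumes "transpose H = H" and "subspace U" and "v \<in> U"
    and nonneg: "\<And>z. z \<in> U \<Longrightarrow> 0 \<le> z \<bullet> (H *v z)" and "v \<bullet> (H *v v) = 0" and "z \<in> U"
  shows "z \<bullet> (H *v v) = 0"
proof (rule linear_coefficient_zero)
  fix s :: real
  have "v + s *\<^sub>R z \<in> U"
    using assms by (simp add: subspace_add subspace_scale)
  then have "0 \<le> (v + s *\<^sub>R z) \<bullet> (H *v (v + s *\<^sub>R z))" by (rule nonneg)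
  also have "\<dots> = 2 * s * (z \<bullet> (H *v v)) + s\<^sup>2 * (z \<bullet> (H *v z))"
    using assms(5) dot_symmetric_matrix[OF assms(1), of v z]
    by (simp add: algebra_simps inner_add_left inner_add_right power2_eq_square)
  finally show "0 \<le> 2 * s * (z \<bullet> (H *v v)) + s\<^sup>2 * (z \<bullet> (H *v z))" .
qed

lemma pos_semidef_kernel:
  assumes "pos_semidef A" and "x \<bullet> (A *v x) = 0"
  shows "A *v x = 0"
proof -
  have "(A *v x) \<bullet> (A *v x) = 0"
    by (rule symmetric_form_minimizer[of A UNIV x]) (use assms in \<open>auto simp: pos_semidef_def\<close>)
  then show ?thesis by simp
qed

lemma pos_semidef_invertible_imp_pos_def:
  assumes "pos_semidef A" and "A ** B = mat 1"
  shows "pos_def A"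
proof -
  have "B ** A = mat 1" using assms(2) matrix_left_right_inverse by blast
  then have "x = 0" if "A *v x = 0" for x
    using that matrix_vector_mul_assoc[of B A x] by simp
  then show ?thesis
    using assms(1) pos_semidef_kernel[OF assms(1)] unfolding pos_semidef_def pos_def_def
    by (metis order_le_less)
qed

lemma trace_quadratic_form: "trace A = (\<Sum>i\<in>UNIV. axis i 1 \<bullet> (A *v axis i 1))"
  for A :: "real^'n^'n"
  by (simp add: trace_def inner_axis' matrix_vector_mult_basis column_def)

lemma pos_semidef_trace_nonneg: "pos_semidef A \<Longrightarrow> 0 \<le> trace A"
  by (simp add: trace_quadratic_form pos_semidef_def sum_nonneg)

lemma pos_semidef_trace_zero:
  assumes "pos_semidef A" and "trace A = 0"
  shows "A = 0"
proof -
  have "\<forall>i. axis i 1 \<bullet> (A *v axis i 1) = 0"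
    using assms by (simp add: trace_quadratic_form pos_semidef_def sum_nonneg_eq_0_iff)
  then have "A *v axis i 1 = 0" for i
    using pos_semidef_kernel[OF assms(1)] by blast
  then show ?thesis
    by (simp add: matrix_vector_mult_basis column_def vec_eq_iff)
qed

text \<open>The form is nonnegative at \<open>e\<^sub>i + e\<^sub>j\<close> and at \<open>e\<^sub>i - e\<^sub>j\<close>, which bounds twice the entry by two diagonal
  entries.\<close>

lemma pos_semidef_entry_le_trace:
  fixes A :: "real^'n^'n"
  assumes "pos_semidef A"
  shows "\<bar>A $ i $ j\<bar> \<le> trace A"
proof -
  let ?a = "axis i 1 :: real^'n" and ?b = "axis j 1 :: real^'n"
  have ent: "axis p 1 \<bullet> (A *v axis q 1) = A $ p $ q" for p q :: 'n
    by (simp add: inner_axis' matrix_vector_mult_basis column_def)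
  have sym: "A $ j $ i = A $ i $ j"
    using assms by (metis pos_semidef_def ent dot_symmetric_matrix)
  have diag: "A $ p $ p \<le> trace A" for p
    unfolding trace_def using assms
    by (intro member_le_sum) (auto simp: pos_semidef_def simp flip: ent)
  have "0 \<le> (?a + ?b) \<bullet> (A *v (?a + ?b))" "0 \<le> (?a - ?b) \<bullet> (A *v (?a - ?b))"
    using assms by (simp_all add: pos_semidef_def)
  then have "0 \<le> A $ i $ i + 2 * A $ i $ j + A $ j $ j" "0 \<le> A $ i $ i - 2 * A $ i $ j + A $ j $ j"
    by (simp_all add: algebra_simps inner_add_left inner_diff_left ent sym)
  with diag[of i] diag[of j] show ?thesis by linarith
qed

text \<open>This turns a bound on the price of an excitation into boundedness, hence into compactness.\<close>

lemma pos_semidef_norm_le_trace: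
  assumes "pos_semidef (A :: real^'n^'n)"
  shows "norm A \<le> real (CARD('n) * CARD('n)) * trace A"
proof -
  have "norm A \<le> (\<Sum>i\<in>UNIV. norm (A $ i))"
    unfolding norm_vec_def by (rule L2_set_le_sum) simp
  also have "\<dots> \<le> (\<Sum>i\<in>UNIV. \<Sum>j\<in>UNIV. \<bar>A $ i $ j\<bar>)"
    by (intro sum_mono norm_le_l1_cart)
  also have "\<dots> \<le> (\<Sum>i\<in>(UNIV::'n set). \<Sum>j\<in>(UNIV::'n set). trace A)"
    by (intro sum_mono pos_semidef_entry_le_trace assms)
  finally show ?thesis by simp
qed

section \<open>Rayleigh quotients, the spectral theorem and square roots\<close>

text \<open>The quotient of the two forms attains its maximum \<open>\<mu>\<close> on the unit sphere of \<open>U\<close>, and a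
  maximizer makes the nonnegative form \<open>\<mu> M - Q\<close> vanish. Taking \<open>M\<close> to be the identity and \<open>U\<close> an
  invariant subspace produces eigenvectors of \<open>Q\<close>; taking \<open>M = Z\<^sup>-\<^sup>1\<close> produces the largest
  eigenvalue of \<open>Z Q\<close>.\<close>

lemma generalized_rayleigh:
  fixes Q M :: "real^'n^'n"
  assumes "transpose Q = Q" and "pos_def M" and "subspace U" and "U \<noteq> {0}"
  shows "\<exists>v \<mu>. v \<in> U \<and> v \<noteq> 0 \<and> (\<forall>z\<in>U. z \<bullet> (Q *v z) \<le> \<mu> * (z \<bullet> (M *v z))) \<and>
    (\<forall>z\<in>U. z \<bullet> (Q *v v) = \<mu> * (z \<bullet> (M *v v)))"
proof -
  let ?S = "sphere 0 1 \<inter> U"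
  let ?g = "\<lambda>z. (z \<bullet> (Q *v z)) / (z \<bullet> (M *v z))"
  have M: "0 < z \<bullet> (M *v z)" if "z \<noteq> 0" for z using assms that by (simp add: pos_def_def)
  obtain u where u: "u \<in> U" "u \<noteq> 0" using assms(3,4) subspace_0 by blast
  have unit: "(1 / norm z) *\<^sub>R z \<in> ?S" if "z \<in> U" "z \<noteq> 0" for z
    using that assms(3) by (simp add: subspace_scale)
  have "compact ?S" by (simp add: closed_subspace assms(3) compact_Int_closed)
  moreover have "?S \<noteq> {}" using unit[OF u] by blast
  moreover have "z \<bullet> (M *v z) \<noteq> 0" if "z \<in> ?S" for z
    using M[of z] that by force
  then have "continuous_on ?S ?g"
    by (intro continuous_intros linear_continuous_on_compose[OF continuous_on_id] ballI) auto
  ultimately obtain v where v: "v \<in> ?S" and max: "\<And>z. z \<in> ?S \<Longrightarrow> ?g z \<le> ?g v"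
    using continuous_attains_sup[of ?S ?g] by blast
  define \<mu> where "\<mu> = ?g v"
  have v': "v \<in> U" "v \<noteq> 0" using v by auto
  have le: "z \<bullet> (Q *v z) \<le> \<mu> * (z \<bullet> (M *v z))" if "z \<in> U" for z
  proof (cases "z = 0")
    case False
    have "?g z = ?g ((1 / norm z) *\<^sub>R z)"
      using False by (simp add: algebra_simps)
    also have "\<dots> \<le> \<mu>" unfolding \<mu>_def using max[OF unit[OF that False]] .
    finally show ?thesis using M[OF False] by (simp add: divide_le_eq)
  qed simp
  let ?H = "\<mu> *\<^sub>R M - Q"
  have H: "z \<bullet> (?H *v w) = \<mu> * (z \<bullet> (M *v w)) - z \<bullet> (Q *v w)" for z w
    by (simp add: matrix_vector_mult_diff_rdistrib matrix_vector_scaleR_left inner_diff_right)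
  have "z \<bullet> (?H *v v) = 0" if "z \<in> U" for z
  proof (rule symmetric_form_minimizer[OF _ assms(3) v'(1) _ _ that])
    show "transpose ?H = ?H"
      using assms by (simp add: pos_def_def transpose_diff transpose_scalar)
    show "0 \<le> z \<bullet> (?H *v z)" if "z \<in> U" for z using le[OF that] by (simp add: H)
    show "v \<bullet> (?H *v v) = 0" using M[OF v'(2)] unfolding H by (simp add: \<mu>_def)
  qed
  then have "z \<bullet> (Q *v v) = \<mu> * (z \<bullet> (M *v v))" if "z \<in> U" for z
    using that by (simp add: H)
  with v' le show ?thesis by blast
qed

lemma orthonormal_eigenvectors_exist:
  fixes A :: "real^'n^'n"
  assumes A: "transpose A = A" and "k \<le> CARD('n)"
  shows "\<exists>B. finite B \<and> card B = k \<and> pairwise orthogonal B \<and>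
    (\<forall>b\<in>B. norm b = 1 \<and> (\<exists>\<mu>. A *v b = \<mu> *\<^sub>R b))"
  using assms(2)
proof (induction k)
  case 0
  show ?case by (rule exI[of _ "{}"]) simp
next
  case (Suc k)
  then obtain B where B: "finite B" "card B = k" "pairwise orthogonal B"
    "\<And>b. b \<in> B \<Longrightarrow> norm b = 1" "\<And>b. b \<in> B \<Longrightarrow> \<exists>\<mu>. A *v b = \<mu> *\<^sub>R b" by auto
  \<comment> \<open>The orthogonal complement of eigenvectors is invariant, so a maximizer of the Rayleigh
    quotient on it is again an eigenvector.\<close>
  let ?U = "{x. \<forall>b\<in>B. b \<bullet> x = 0}"
  have U: "subspace ?U" by (auto simp: subspace_def inner_add_right)
  have "dim B < DIM(real^'n)" using dim_le_card'[OF B(1)] B(2) Suc.prems by simp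
  then obtain x where "x \<noteq> 0" "\<And>y. y \<in> span B \<Longrightarrow> orthogonal x y"
    using orthogonal_to_subspace_exists by blast
  then have "?U \<noteq> {0}" using span_base[of _ B] by (auto simp: orthogonal_def inner_commute)
  from generalized_rayleigh[OF A pos_def_mat_1 U this]
  obtain v \<mu> where v: "v \<in> ?U" "v \<noteq> 0"
    and ray: "\<forall>z\<in>?U. z \<bullet> (A *v v) = \<mu> * (z \<bullet> (mat 1 *v v))" by blast
  let ?r = "A *v v - \<mu> *\<^sub>R v"
  have "b \<bullet> (A *v v) = 0" if "b \<in> B" for b
    using B(5)[OF that] v(1) that dot_symmetric_matrix[OF A, of b v] by (auto simp: inner_commute)
  then have "?r \<in> ?U" using v(1) by (simp add: inner_diff_right)
  with ray have "?r \<bullet> (A *v v) = \<mu> * (?r \<bullet> (mat 1 *v v))" by blast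
  then have "?r \<bullet> ?r = 0" by (simp add: inner_diff_right)
  then have eig: "A *v v = \<mu> *\<^sub>R v" by simp
  define w where "w = (1 / norm v) *\<^sub>R v"
  have w: "norm w = 1" "A *v w = \<mu> *\<^sub>R w" "\<And>b. b \<in> B \<Longrightarrow> b \<bullet> w = 0"
    using v by (auto simp: w_def eig matrix_vector_mult_scaleR)
  have "w \<notin> B" using w(1) w(3)[of w] by (auto simp: norm_eq_1)
  moreover have "pairwise orthogonal (insert w B)"
    using B(3) w(3) by (auto simp: pairwise_insert) (auto simp: orthogonal_def inner_commute)
  ultimately show ?case
    using B w(1,2) by (intro exI[of _ "insert w B"]) auto
qed

theorem spectral_theorem:
  fixes A :: "real^'n^'n"
  assumes "transpose A = A"
  obtains B \<mu> where "finite B" "pairwise orthogonal B" "\<And>b. b \<in> B \<Longrightarrow> norm b = 1"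
    "span B = UNIV" "\<And>b. b \<in> B \<Longrightarrow> A *v b = \<mu> b *\<^sub>R b"
proof -
  obtain B where B: "finite B" "card B = CARD('n)" "pairwise orthogonal B"
    "\<And>b. b \<in> B \<Longrightarrow> norm b = 1" "\<And>b. b \<in> B \<Longrightarrow> \<exists>\<mu>. A *v b = \<mu> *\<^sub>R b"
    using orthonormal_eigenvectors_exist[OF assms order_refl] by blast
  moreover from B(4)[of 0] have "0 \<notin> B" by auto
  ultimately have "independent B" by (intro pairwise_orthogonal_independent)
  then have "span B = UNIV"
    using B(1,2) card_ge_dim_independent[of B UNIV] by (simp add: top.extremum_unique)
  with B show ?thesis using that by metis
qed

lemma outer_self_mult: "outer_self v *v x = (v \<bullet> x) *\<^sub>R v"
  by (simp add: outer_self_def matrix_vector_mult_def vec_eq_iff inner_vec_def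
      sum_distrib_left sum_distrib_right algebra_simps)

lemma transpose_outer_self: "transpose (outer_self v) = outer_self v"
  by (simp add: outer_self_def transpose_def vec_eq_iff mult.commute)

lemma pos_semidef_outer_self: "pos_semidef (outer_self v)"
  by (simp add: pos_semidef_def transpose_outer_self outer_self_mult inner_commute)

text \<open>On an orthonormal eigenbasis \<open>b\<close> with eigenvalues \<open>\<mu> b\<close> the root is \<open>\<Sum>b. \<surd>(\<mu> b) b b\<^sup>T\<close>.\<close>

lemma pos_semidef_sqrt_exists:
  assumes "pos_semidef A"
  shows "\<exists>R. pos_semidef R \<and> R ** R = A"
proof -
  have sym: "transpose A = A" using assms by (simp add: pos_semidef_def)
  obtain B \<mu> where B: "finite B" "pairwise orthogonal B" "\<And>b. b \<in> B \<Longrightarrow> norm b = 1"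
    "span B = UNIV" "\<And>b. b \<in> B \<Longrightarrow> A *v b = \<mu> b *\<^sub>R b"
    using spectral_theorem[OF sym] by metis
  have \<mu>: "0 \<le> \<mu> b" if "b \<in> B" for b
  proof -
    have "0 \<le> b \<bullet> (A *v b)" using assms by (simp add: pos_semidef_def)
    then show ?thesis using B(3,5)[OF that] by (simp add: norm_eq_1)
  qed
  define R where "R = (\<Sum>b\<in>B. sqrt (\<mu> b) *\<^sub>R outer_self b)"
  have psd: "pos_semidef R"
    unfolding R_def by (intro pos_semidef_sum pos_semidef_scaleR pos_semidef_outer_self) (simp add: \<mu>)
  have R: "R *v b = sqrt (\<mu> b) *\<^sub>R b" if "b \<in> B" for b
  proof -
    have "R *v b = (\<Sum>c\<in>B. (sqrt (\<mu> c) * (c \<bullet> b)) *\<^sub>R c)"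
      by (simp add: R_def matrix_vector_sum_left matrix_vector_scaleR_left outer_self_mult)
    also have "\<dots> = (\<Sum>c\<in>B. if c = b then sqrt (\<mu> b) *\<^sub>R b else 0)"
      using B(2) B(3)[OF that] that
      by (intro sum.cong) (auto simp: pairwise_def orthogonal_def norm_eq_1)
    finally show ?thesis using B(1) that by simp
  qed
  have "(R ** R) *v x = A *v x" for x
  proof (rule linear_eq_on_span[of "\<lambda>x. (R ** R) *v x" "\<lambda>x. A *v x" B])
    show "(R ** R) *v b = A *v b" if "b \<in> B" for b
      using B(5)[OF that] \<mu>[OF that] R[OF that]
      by (simp add: matrix_vector_mult_scaleR flip: matrix_vector_mul_assoc)
  qed (use B(4) in auto)
  with psd show ?thesis by (auto simp: matrix_eq)
qed

text \<open>If \<open>B\<^sup>2 = C\<^sup>2\<close>, then \<open>D = B - C\<close> satisfies \<open>B D = - D C\<close>, so \<open>D B D\<close> and \<open>D C D\<close> are positive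
  semidefinite with traces adding up to zero; hence \<open>B D = C D = 0\<close> and \<open>D\<^sup>2 = 0\<close>.\<close>

lemma pos_semidef_sqrt_unique:
  assumes B: "pos_semidef B" and C: "pos_semidef C" and eq: "B ** B = C ** C"
  shows "B = C"
proof -
  define D where "D = B - C"
  have sym: "transpose D = D"
    using B C by (simp add: D_def pos_semidef_def transpose_diff)
  have psd: "pos_semidef (D ** B ** D)" "pos_semidef (D ** C ** D)"
    using pos_semidef_congruence[of _ D] B C sym by auto
  have BD: "B ** D = - (D ** C)"
    by (simp add: D_def eq matrix_diff_ldistrib matrix_diff_rdistrib)
  have "trace (D ** B ** D) = trace (D ** (B ** D))" by (simp add: matrix_mul_assoc)
  also have "\<dots> = trace (- (D ** (D ** C)))"
    by (simp add: BD matrix_scaleR_right[of D "-1", simplified])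
  also have "\<dots> = - trace (D ** (D ** C))" by (simp add: trace_def sum_negf)
  also have "trace (D ** (D ** C)) = trace (D ** C ** D)" by (rule trace_mul_sym)
  finally have "trace (D ** B ** D) = 0" "trace (D ** C ** D) = 0"
    using psd[THEN pos_semidef_trace_nonneg] by linarith+
  then have zero: "D ** B ** D = 0" "D ** C ** D = 0"
    using psd pos_semidef_trace_zero by blast+
  have van: "E *v (D *v x) = 0" if "pos_semidef E" "D ** E ** D = 0" for E x
  proof (rule pos_semidef_kernel[OF that(1)])
    show "(D *v x) \<bullet> (E *v (D *v x)) = 0"
      using quadratic_form_congruence[of x D E] sym that(2) by simp
  qed
  have "D *v x = 0" for x
  proof -
    have "D *v (D *v x) = 0"
      using van[OF B zero(1), of x] van[OF C zero(2), of x]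
      by (simp add: D_def[THEN arg_cong, of "\<lambda>M. M *v (D *v x)"] matrix_vector_mult_diff_rdistrib)
    then have "(D *v x) \<bullet> (D *v x) = 0"
      using dot_symmetric_matrix[OF sym, of "D *v x" x] by simp
    then show ?thesis by simp
  qed
  then show ?thesis by (simp add: D_def matrix_eq matrix_vector_mult_diff_rdistrib)
qed

lemma psd_sqrt_works:
  assumes "pos_semidef A"
  shows "pos_semidef (psd_sqrt A)" and "psd_sqrt A ** psd_sqrt A = A"
proof -
  have "\<exists>!R. pos_semidef R \<and> R ** R = A"
    using pos_semidef_sqrt_exists[OF assms] pos_semidef_sqrt_unique by metis
  from theI'[OF this] show "pos_semidef (psd_sqrt A)" "psd_sqrt A ** psd_sqrt A = A"
    by (simp_all add: psd_sqrt_def)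
qed

text \<open>If \<open>R\<^sup>2 = A\<close>, then \<open>R A\<^sup>-\<^sup>1\<close> is an inverse of \<open>R\<close>.\<close>

lemma pos_def_psd_sqrt:
  assumes "pos_def A"
  shows "pos_def (psd_sqrt A)"
proof -
  let ?R = "psd_sqrt A"
  note R = psd_sqrt_works[OF pos_def_imp_pos_semidef[OF assms]]
  have "?R ** (?R ** matrix_inv A) = mat 1"
    by (simp add: matrix_mul_assoc R pos_def_inverse[OF assms])
  then show ?thesis using pos_semidef_invertible_imp_pos_def R(1) by blast
qed

lemma pd_sqrt_works:
  assumes "pos_def A"
  shows "pos_def (pd_sqrt A)" and "pd_sqrt A ** pd_sqrt A = A"
proof -
  have "\<exists>!R. pos_def R \<and> R ** R = A"
    using psd_sqrt_works(2) pos_def_psd_sqrt assms pos_semidef_sqrt_unique pos_def_imp_pos_semidef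
    by metis
  from theI'[OF this] show "pos_def (pd_sqrt A)" "pd_sqrt A ** pd_sqrt A = A"
    by (simp_all add: pd_sqrt_def)
qed

section \<open>Trace inequalities for inverses\<close>

text \<open>Cyclicity of the trace turns the product with \<open>W\<close> into a congruence, which inherits the
  definiteness of \<open>M\<close>.\<close>

lemma trace_mult_psd_sqrt:
  assumes "pos_semidef W"
  shows "trace (W ** M) = trace (transpose (psd_sqrt W) ** M ** psd_sqrt W)"
proof -
  let ?R = "psd_sqrt W"
  have "trace (W ** M) = trace (?R ** (?R ** M))"
    using psd_sqrt_works(2)[OF assms] by (simp add: matrix_mul_assoc)
  also have "\<dots> = trace (?R ** M ** ?R)" by (rule trace_mul_sym)
  finally show ?thesis using psd_sqrt_works(1)[OF assms] by (simp add: pos_semidef_def)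
qed

lemma trace_mult_nonneg: "pos_semidef W \<Longrightarrow> pos_semidef M \<Longrightarrow> 0 \<le> trace (W ** M)"
  by (simp only: trace_mult_psd_sqrt pos_semidef_trace_nonneg pos_semidef_congruence)

lemma trace_mult_zero:
  assumes W: "pos_def W" and M: "pos_semidef M" and "trace (W ** M) = 0"
  shows "M = 0"
proof -
  let ?R = "psd_sqrt W"
  have R: "pos_def ?R" using W by (rule pos_def_psd_sqrt)
  have "transpose ?R ** M ** ?R = 0"
    using assms(3) trace_mult_psd_sqrt[OF pos_def_imp_pos_semidef[OF W], of M]
      pos_semidef_trace_zero[OF pos_semidef_congruence[OF M]] by metis
  then have zero: "?R ** M ** ?R = 0" using R by (simp add: pos_def_def)
  have "M = (matrix_inv ?R ** ?R) ** M ** (?R ** matrix_inv ?R)"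
    by (simp add: pos_def_inverse[OF R])
  also have "\<dots> = matrix_inv ?R ** (?R ** M ** ?R) ** matrix_inv ?R"
    by (simp add: matrix_mul_assoc)
  finally show ?thesis by (simp add: zero)
qed

text \<open>As a function of \<open>B\<close> this is an affine minorant of \<open>tr (W B\<^sup>-\<^sup>1)\<close>; it is the tangent where
  \<open>B\<^sup>-\<^sup>1 = P\<close>. Matrices \<open>P\<close> that are neither symmetric nor
  invertible are allowed because the singular case needs them.\<close>

definition inverse_minorant :: "real^'n^'n \<Rightarrow> real^'n^'n \<Rightarrow> real^'n^'n \<Rightarrow> real" where
  "inverse_minorant W P B = 2 * trace (W ** P) - trace (P ** W ** transpose P ** B)"

text \<open>Completing the square in \<open>P\<close>.\<close>

lemma inverse_minorant_gap:
  assumes W: "transpose W = W" and B: "pos_def B"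
  shows "trace (W ** matrix_inv B) - inverse_minorant W P B =
    trace (W ** (transpose (matrix_inv B - P) ** B ** (matrix_inv B - P)))"
proof -
  let ?I = "matrix_inv B"
  have I: "transpose ?I = ?I" using pos_def_matrix_inv[OF B] by (simp add: pos_def_def)
  have "transpose (?I - P) ** B ** (?I - P) = ?I - P - transpose P + transpose P ** B ** P"
    by (simp add: transpose_diff I matrix_diff_ldistrib matrix_diff_rdistrib pos_def_inverse[OF B]
        flip: matrix_mul_assoc)
  moreover have "trace (W ** transpose P) = trace (W ** P)"
    by (metis W matrix_transpose_mul trace_mul_sym trace_transpose transpose_transpose)
  moreover have "trace (W ** (transpose P ** B ** P)) = trace (P ** W ** transpose P ** B)"
    using trace_mul_sym[of P "W ** transpose P ** B"] by (simp add: matrix_mul_assoc)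
  ultimately show ?thesis
    by (simp add: inverse_minorant_def matrix_add_ldistrib matrix_diff_ldistrib trace_add trace_sub)
qed

lemma inverse_minorant_le:
  assumes "pos_def W" and "pos_def B"
  shows "inverse_minorant W P B \<le> trace (W ** matrix_inv B)"
proof -
  have "0 \<le> trace (W ** (transpose (matrix_inv B - P) ** B ** (matrix_inv B - P)))"
    using assms by (intro trace_mult_nonneg pos_semidef_congruence pos_def_imp_pos_semidef)
  then show ?thesis
    using inverse_minorant_gap[of W B P] assms by (simp add: pos_def_def)
qed

text \<open>The gap is \<open>tr (W D\<^sup>T B D)\<close> with \<open>D = B\<^sup>-\<^sup>1 - P\<close>, which vanishes only for \<open>D = 0\<close>. This strictness is
  the source of all uniqueness statements below.\<close>

lemma inverse_minorant_eq_iff: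
  assumes W: "pos_def W" and B: "pos_def B"
  shows "inverse_minorant W P B = trace (W ** matrix_inv B) \<longleftrightarrow> P = matrix_inv B"
proof
  let ?D = "matrix_inv B - P"
  have gap: "trace (W ** matrix_inv B) - inverse_minorant W P B = trace (W ** (transpose ?D ** B ** ?D))"
    using inverse_minorant_gap[of W B P] W B by (simp add: pos_def_def)
  show "P = matrix_inv B" if "inverse_minorant W P B = trace (W ** matrix_inv B)"
  proof -
    have zero: "transpose ?D ** B ** ?D = 0"
      using trace_mult_zero[OF W] gap that pos_semidef_congruence pos_def_imp_pos_semidef[OF B] by auto
    have "?D *v x = 0" for x
    proof (rule ccontr)
      assume "?D *v x \<noteq> 0"
      then have "0 < (?D *v x) \<bullet> (B *v (?D *v x))" using B by (simp add: pos_def_def)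
      then show False using quadratic_form_congruence[of x ?D B] zero by simp
    qed
    then show ?thesis by (simp add: matrix_eq matrix_vector_mult_diff_rdistrib)
  qed
  show "inverse_minorant W P B = trace (W ** matrix_inv B)" if "P = matrix_inv B"
    using gap that by (simp add: trace_zero)
qed

lemma inverse_minorant_at_inverse:
  "pos_def W \<Longrightarrow> pos_def B \<Longrightarrow> inverse_minorant W (matrix_inv B) B = trace (W ** matrix_inv B)"
  by (simp add: inverse_minorant_eq_iff)

lemma inverse_minorant_midpoint:
  "inverse_minorant W P ((1/2) *\<^sub>R (A + B)) = (inverse_minorant W P A + inverse_minorant W P B) / 2"
  by (simp add: inverse_minorant_def matrix_scaleR_right matrix_add_ldistrib trace_add trace_scaleR
      field_simps)

text \<open>The minorant that touches at \<open>B\<close>, evaluated at \<open>A\<close>.\<close>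

lemma trace_inverse_increment:
  assumes W: "pos_def W" and A: "pos_def A" and B: "pos_def B"
  shows "trace (W ** matrix_inv B) + trace (matrix_inv B ** W ** matrix_inv B ** (B - A))
    \<le> trace (W ** matrix_inv A)"
proof -
  let ?I = "matrix_inv B"
  have sym: "transpose ?I = ?I" using pos_def_matrix_inv[OF B] by (simp add: pos_def_def)
  have "trace (?I ** W ** ?I ** B) = trace (W ** ?I)"
    using trace_mul_sym[of "?I" W] by (simp add: pos_def_inverse[OF B] flip: matrix_mul_assoc)
  then have "inverse_minorant W ?I A = trace (W ** ?I) + trace (?I ** W ** ?I ** (B - A))"
    by (simp add: inverse_minorant_def sym matrix_diff_ldistrib trace_sub)
  with inverse_minorant_le[OF W A, of ?I] show ?thesis by simp
qed

text \<open>The first-order term of \<open>trace_inverse_increment\<close> is the trace of a positive definite matrix times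
  \<open>B - A\<close>, hence nonnegative and zero only if \<open>B = A\<close>.\<close>

lemma trace_inverse_strict_antimono:
  assumes W: "pos_def W" and A: "pos_def A" and BA: "pos_semidef (B - A)"
  shows "trace (W ** matrix_inv B) \<le> trace (W ** matrix_inv A)"
    and "trace (W ** matrix_inv B) = trace (W ** matrix_inv A) \<Longrightarrow> A = B"
proof -
  have B: "pos_def B" using pos_def_add_pos_semidef[OF A BA] by simp
  let ?I = "matrix_inv B"
  have I: "pos_def ?I" by (rule pos_def_matrix_inv[OF B])
  have Q: "pos_def (?I ** W ** ?I)" by (rule pos_def_symmetric_congruence[OF W I])
  have nonneg: "0 \<le> trace (?I ** W ** ?I ** (B - A))"
    by (rule trace_mult_nonneg[OF pos_def_imp_pos_semidef[OF Q] BA])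
  note increment = trace_inverse_increment[OF W A B]
  show "trace (W ** ?I) \<le> trace (W ** matrix_inv A)"
    using nonneg increment by linarith
  show "A = B" if "trace (W ** ?I) = trace (W ** matrix_inv A)"
  proof -
    have "trace (?I ** W ** ?I ** (B - A)) = 0" using nonneg increment that by linarith
    then have "B - A = 0" by (rule trace_mult_zero[OF Q BA])
    then show ?thesis by simp
  qed
qed

lemma trace_outer_self: "trace (A ** outer_self x) = x \<bullet> (A *v x)"
proof -
  have "trace (A ** outer_self x) = (\<Sum>i\<in>UNIV. x $ i * (A *v x) $ i)"
    by (simp add: trace_quadratic_form outer_self_mult inner_axis inner_axis' matrix_vector_mult_scaleR
        flip: matrix_vector_mul_assoc)
  then show ?thesis by (simp add: inner_vec_def)
qed

lemma outer_self_sandwich: "outer_self x ** A ** outer_self x = (x \<bullet> (A *v x)) *\<^sub>R outer_self x"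
  by (simp add: matrix_eq outer_self_mult matrix_vector_scaleR_left matrix_vector_mult_scaleR
      inner_commute flip: matrix_vector_mul_assoc)

text \<open>If \<open>x \<bullet> (B *v x)\<close> is small, this minorant is large for large \<open>s\<close>; it keeps a sequence of bounded
  cost away from the singular matrices.\<close>

lemma inverse_minorant_outer_self:
  "inverse_minorant W (s *\<^sub>R outer_self x) B =
     2 * s * (x \<bullet> (W *v x)) - s\<^sup>2 * (x \<bullet> (W *v x)) * (x \<bullet> (B *v x))"
proof -
  have "trace (outer_self x ** B) = x \<bullet> (B *v x)"
    using trace_mul_sym[of "outer_self x" B] by (simp add: trace_outer_self)
  then show ?thesis
    by (simp add: inverse_minorant_def matrix_scaleR_left matrix_scaleR_right transpose_scalar
        transpose_outer_self outer_self_sandwich trace_scaleR trace_outer_self power2_eq_square)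
qed

section \<open>Injecting all information in the first step\<close>

text \<open>The cost of injecting \<open>X\<close> at the first step and nothing afterwards.\<close>

definition static_cost ::
  "real^'n^'n \<Rightarrow> real^'n^'n \<Rightarrow> real^'n^'n \<Rightarrow> nat \<Rightarrow> real^'n^'n \<Rightarrow> real" where
  "static_cost W Z Le T X =
     (\<Sum>t=1..T. trace (W ** matrix_inv (real t *\<^sub>R Le + X))) + trace (matrix_inv Z ** X)"

definition static_feasible :: "real^'n^'n \<Rightarrow> real^'n^'n \<Rightarrow> bool" where
  "static_feasible Le X \<longleftrightarrow> pos_semidef X \<and> pos_def (Le + X)"

definition static_optimal ::
  "real^'n^'n \<Rightarrow> real^'n^'n \<Rightarrow> real^'n^'n \<Rightarrow> nat \<Rightarrow> real^'n^'n \<Rightarrow> bool" where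
  "static_optimal W Z Le T X \<longleftrightarrow> static_feasible Le X \<and>
     (\<forall>Y. static_feasible Le Y \<longrightarrow> static_cost W Z Le T X \<le> static_cost W Z Le T Y)"

lemma static_feasible_pos_def:
  assumes "pos_semidef Le" and "static_feasible Le X" and "1 \<le> t"
  shows "pos_def (real t *\<^sub>R Le + X)"
proof -
  have "real t *\<^sub>R Le + X = (Le + X) + (real t - 1) *\<^sub>R Le"
    by (simp add: algebra_simps)
  also have "pos_def \<dots>"
    by (rule pos_def_add_pos_semidef) (use assms in \<open>auto simp: static_feasible_def intro: pos_semidef_scaleR\<close>)
  finally show ?thesis .
qed

lemma cost_eq_static_cost:
  assumes "\<forall>t\<in>{2..T}. L t = 0" and "1 \<le> T"
  shows "cost W Z Le T L = static_cost W Z Le T (L 1)"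
proof -
  have L: "(\<Sum>k=1..t. f k) = f 1" if "t \<in> {1..T}" "\<forall>k\<in>{2..T}. f k = 0" for t and f :: "nat \<Rightarrow> 'z::comm_monoid_add"
  proof -
    have "(\<Sum>k=1..t. f k) = (\<Sum>k\<in>{1}. f k)"
      using that by (intro sum.mono_neutral_right) auto
    then show ?thesis by simp
  qed
  have "(\<Sum>t=1..T. trace (matrix_inv Z ** L t)) = trace (matrix_inv Z ** L 1)"
    using assms by (intro L) (auto simp: trace_zero)
  moreover have "fisher_info Le L t = real t *\<^sub>R Le + L 1" if "t \<in> {1..T}" for t
    using L[OF that assms(1)] by (simp add: fisher_info_def)
  ultimately show ?thesis
    by (simp add: cost_def static_cost_def sum.distrib)
qed

lemma feasible_iff_static_feasible:
  assumes "\<forall>t\<in>{2..T}. L t = 0" and "1 \<le> T"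
  shows "feasible Le T L \<longleftrightarrow> static_feasible Le (L 1)"
proof -
  have "pos_semidef (L t)" if "pos_semidef (L 1)" "t \<in> {1..T}" for t
    using that assms by (cases "t = 1") (auto simp: pos_semidef_zero)
  then show ?thesis
    using assms(2) by (auto simp: feasible_def static_feasible_def add.commute)
qed

text \<open>The price depends only on the sum \<open>X\<close> of the injected information, while each \<open>t L\<^sub>e + X\<close>
  dominates the information available at time \<open>t\<close>. Equal costs force all partial sums to coincide
  with \<open>X\<close>, hence all later injections to vanish.\<close>

lemma cost_ge_static_cost:
  assumes W: "pos_def W" and Le: "pos_semidef Le" and T: "1 \<le> T" and L: "feasible Le T L"
  defines "X \<equiv> \<Sum>k=1..T. L k"
  shows "static_feasible Le X" and "static_cost W Z Le T X \<le> cost W Z Le T L"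
    and "static_cost W Z Le T X = cost W Z Le T L \<Longrightarrow> \<forall>t\<in>{2..T}. L t = 0"
proof -
  have psd: "pos_semidef (L t)" if "t \<in> {1..T}" for t using L that by (simp add: feasible_def)
  have first: "pos_def (Le + L 1)" using L by (simp add: feasible_def add.commute)
  have static_feasible_partial: "static_feasible Le (\<Sum>k=1..t. L k)" if "t \<in> {1..T}" for t
  proof -
    have split: "(\<Sum>k=1..t. L k) = L 1 + (\<Sum>k=2..t. L k)"
      using that by (simp add: sum.atLeast_Suc_atMost numeral_2_eq_2)
    have "pos_semidef (\<Sum>k=2..t. L k)" "pos_semidef (\<Sum>k=1..t. L k)"
      using psd that by (auto intro!: pos_semidef_sum)
    then show ?thesis
      using pos_def_add_pos_semidef[OF first] unfolding static_feasible_def split add.assoc by blast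
  qed
  from static_feasible_partial[of T] T show X: "static_feasible Le X"
    by (simp add: X_def)
  let ?a = "\<lambda>t. trace (W ** matrix_inv (fisher_info Le L t))"
  let ?b = "\<lambda>t. trace (W ** matrix_inv (real t *\<^sub>R Le + X))"
  have costs: "cost W Z Le T L = sum ?a {1..T} + trace (matrix_inv Z ** X)"
    "static_cost W Z Le T X = sum ?b {1..T} + trace (matrix_inv Z ** X)"
    by (simp_all add: cost_def static_cost_def X_def sum.distrib trace_sum matrix_sum_right)
  have pd: "pos_def (fisher_info Le L t)" if "t \<in> {1..T}" for t
    using static_feasible_pos_def[OF Le static_feasible_partial[OF that]] that
    by (simp add: fisher_info_def)
  have diff: "pos_semidef ((real t *\<^sub>R Le + X) - fisher_info Le L t)" if "t \<in> {1..T}" for t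
  proof -
    have "X = (\<Sum>k=1..t. L k) + (\<Sum>k=Suc t..T. L k)"
      unfolding X_def using that sum.ub_add_nat[of 1 t L "T - t"] by simp
    then show ?thesis using that psd by (auto simp: fisher_info_def intro!: pos_semidef_sum)
  qed
  have le: "?b t \<le> ?a t" and eq: "?b t = ?a t \<Longrightarrow> fisher_info Le L t = real t *\<^sub>R Le + X"
    if "t \<in> {1..T}" for t
    using trace_inverse_strict_antimono[OF W pd diff] that by blast+
  show "static_cost W Z Le T X \<le> cost W Z Le T L"
    unfolding costs using le by (intro add_right_mono sum_mono)
  show "\<forall>t\<in>{2..T}. L t = 0" if "static_cost W Z Le T X = cost W Z Le T L"
  proof
    fix t assume t: "t \<in> {2..T}"
    have "sum ?b {1..T} = sum ?a {1..T}" using that by (simp only: costs add_right_cancel)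
    then have "?b s = ?a s" if "s \<in> {1..T}" for s
      by (rule sum_mono_inv[OF _ le that]) simp_all
    then have "(\<Sum>k=1..s. L k) = X" if "s \<in> {1..T}" for s
      using eq[of s] that by (simp add: fisher_info_def)
    moreover have "t - 1 \<in> {1..T}" "t \<in> {1..T}" using t by auto
    ultimately have "(\<Sum>k=1..t - 1. L k) = X" "(\<Sum>k=1..t. L k) = X" by blast+
    moreover have "(\<Sum>k=1..t. L k) = (\<Sum>k=1..t - 1. L k) + L t"
      using t sum.cl_ivl_Suc[of L 1 "t - 1"] by simp
    ultimately show "L t = 0" by simp
  qed
qed

section \<open>The static problem has exactly one minimizer\<close>

text \<open>Strict convexity at the midpoint: the minorants that touch at the midpoint average to the cost
  there, and they lie below the costs of both minimizers. So they touch at both minimizers as well,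
  which forces equal inverses.\<close>

lemma static_optimal_unique:
  assumes W: "pos_def W" and Le: "pos_semidef Le" and T: "1 \<le> T"
    and X: "static_optimal W Z Le T X" and Y: "static_optimal W Z Le T Y"
  shows "X = Y"
proof -
  let ?M = "(1/2) *\<^sub>R (X + Y)"
  let ?F = "\<lambda>X t. real t *\<^sub>R Le + X"
  let ?g = "\<lambda>X t. inverse_minorant W (matrix_inv (?F ?M t)) (?F X t)"
  have fX: "static_feasible Le X" and fY: "static_feasible Le Y"
    using X Y by (simp_all add: static_optimal_def)
  have mid: "?F ?M t = (1/2) *\<^sub>R (?F X t + ?F Y t)" for t
    by (simp add: vec_eq_iff field_simps)
  have fM: "static_feasible Le ?M"
  proof -
    have "pos_def ((1/2) *\<^sub>R ((Le + X) + (Le + Y)))"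
      using fX fY pos_def_scaleR[OF _ pos_def_add_pos_semidef[of "Le + X" "Le + Y"]]
        pos_def_imp_pos_semidef[of "Le + Y"]
      by (simp add: static_feasible_def)
    then show ?thesis
      using fX fY mid[of 1]
      by (auto simp: static_feasible_def intro: pos_semidef_scaleR pos_semidef_add)
  qed
  have lX: "?g X t \<le> trace (W ** matrix_inv (?F X t))"
    and lY: "?g Y t \<le> trace (W ** matrix_inv (?F Y t))" if "t \<in> {1..T}" for t
    using that by (auto intro!: inverse_minorant_le[OF W] static_feasible_pos_def[OF Le] fX fY)
  have eM: "trace (W ** matrix_inv (?F ?M t)) = (?g X t + ?g Y t) / 2" if "t \<in> {1..T}" for t
  proof -
    have "pos_def (?F ?M t)" using static_feasible_pos_def[OF Le fM] that by simp
    from inverse_minorant_at_inverse[OF W this]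
    have "trace (W ** matrix_inv (?F ?M t)) = ?g ?M t" by (rule sym)
    also have "\<dots> = (?g X t + ?g Y t) / 2"
      by (subst (2) mid) (rule inverse_minorant_midpoint)
    finally show ?thesis .
  qed
  have cost_M: "static_cost W Z Le T ?M = ((\<Sum>t=1..T. ?g X t) + trace (matrix_inv Z ** X)) / 2
      + ((\<Sum>t=1..T. ?g Y t) + trace (matrix_inv Z ** Y)) / 2"
    by (simp add: static_cost_def eM sum_divide_distrib[symmetric] sum.distrib matrix_scaleR_right
        trace_scaleR matrix_add_ldistrib trace_add add_divide_distrib)
  have min: "static_cost W Z Le T X \<le> static_cost W Z Le T ?M"
    "static_cost W Z Le T Y \<le> static_cost W Z Le T ?M"
    using X Y fM by (auto simp: static_optimal_def)
  have sX: "(\<Sum>t=1..T. ?g X t) \<le> (\<Sum>t=1..T. trace (W ** matrix_inv (?F X t)))"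
    and sY: "(\<Sum>t=1..T. ?g Y t) \<le> (\<Sum>t=1..T. trace (W ** matrix_inv (?F Y t)))"
    using lX lY by (auto intro!: sum_mono)
  have uX: "(\<Sum>t=1..T. trace (W ** matrix_inv (?F X t))) \<le> (\<Sum>t=1..T. ?g X t)"
    and uY: "(\<Sum>t=1..T. trace (W ** matrix_inv (?F Y t))) \<le> (\<Sum>t=1..T. ?g Y t)"
    using cost_M min sX sY static_cost_def[of W Z Le T X] static_cost_def[of W Z Le T Y] by argo+
  have "?g X 1 = trace (W ** matrix_inv (?F X 1))"
    by (rule sum_mono_inv[OF order_antisym[OF sX uX] lX]) (use T in auto)
  moreover have "?g Y 1 = trace (W ** matrix_inv (?F Y 1))"
    by (rule sum_mono_inv[OF order_antisym[OF sY uY] lY]) (use T in auto)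
  moreover have FX: "pos_def (?F X 1)" and FY: "pos_def (?F Y 1)"
    using static_feasible_pos_def[OF Le fX, of 1] static_feasible_pos_def[OF Le fY, of 1] by simp_all
  ultimately have "matrix_inv (?F X 1) = matrix_inv (?F Y 1)"
    using inverse_minorant_eq_iff[OF W FX] inverse_minorant_eq_iff[OF W FY] by simp
  then have "?F X 1 = ?F Y 1"
    using matrix_inv_unique[OF pos_def_inverse(2)[OF FX]] matrix_inv_unique[OF pos_def_inverse(2)[OF FY]]
    by simp
  then show ?thesis by simp
qed

lemma tendsto_linear_matrix:
  fixes f :: "real^'n^'n \<Rightarrow> real"
  assumes "linear f" and "X \<longlonglongrightarrow> A"
  shows "(\<lambda>n. f (X n)) \<longlonglongrightarrow> f A"
  using assms bounded_linear.tendsto linear_conv_bounded_linear by blast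

lemma linear_trace_mult: "linear (\<lambda>X. trace (M ** X))"
  for M :: "real^'n^'n"
  by (rule linearI) (simp_all add: matrix_add_ldistrib trace_add matrix_scaleR_right trace_scaleR)

lemma linear_quadratic_form: "linear (\<lambda>X. x \<bullet> (X *v x))"
  for x :: "real^'n"
  by (rule linearI)
    (simp_all add: matrix_vector_mult_add_rdistrib inner_add_right matrix_vector_scaleR_left)

lemma pos_semidef_limit:
  assumes "\<And>n. pos_semidef (X n)" and "X \<longlonglongrightarrow> A"
  shows "pos_semidef A"
  unfolding pos_semidef_def
proof (intro conjI allI)
  show "0 \<le> x \<bullet> (A *v x)" for x
    using tendsto_linear_matrix[OF linear_quadratic_form assms(2), of x] assms(1)
    by (intro LIMSEQ_le_const) (auto simp: pos_semidef_def)
  have sym: "X n $ j $ i = X n $ i $ j" for n i j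
  proof -
    have "transpose (X n) $ i $ j = X n $ i $ j" using assms(1)[of n] by (simp add: pos_semidef_def)
    then show ?thesis by (simp add: transpose_def)
  qed
  have "A $ j $ i = A $ i $ j" for i j
  proof (rule LIMSEQ_unique)
    show "(\<lambda>n. X n $ j $ i) \<longlonglongrightarrow> A $ j $ i" using assms(2) by (intro tendsto_vec_nth)
    show "(\<lambda>n. X n $ j $ i) \<longlonglongrightarrow> A $ i $ j"
      using assms(2) by (subst sym) (intro tendsto_vec_nth)
  qed
  then show "transpose A = A" by (simp add: transpose_def vec_eq_iff)
qed

lemma static_cost_terms_nonneg:
  assumes W: "pos_def W" and Z: "pos_def Z" and Le: "pos_semidef Le" and X: "static_feasible Le X"
  shows "0 \<le> trace (matrix_inv Z ** X)"
    and "t \<in> {1..T} \<Longrightarrow> 0 \<le> trace (W ** matrix_inv (real t *\<^sub>R Le + X))"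
  using assms static_feasible_pos_def[OF Le X]
  by (auto simp: static_feasible_def intro!: trace_mult_nonneg pos_def_imp_pos_semidef pos_def_matrix_inv)

text \<open>The direct method. The price bounds a minimizing sequence, so a subsequence converges to some
  \<open>A\<close>. The affine minorants that touch at \<open>A\<close> pass to the limit and show that the cost of \<open>A\<close> is at
  most the infimum.\<close>

lemma static_optimal_exists:
  fixes W Z Le :: "real^'n^'n"
  assumes W: "pos_def W" and Z: "pos_def Z" and Le: "pos_semidef Le" and T: "1 \<le> T"
  shows "\<exists>X. static_optimal W Z Le T X"
proof -
  let ?f = "static_cost W Z Le T"
  define F where "F = {X. static_feasible Le X}"
  define m where "m = (INF X\<in>F. ?f X)"
  have pd: "pos_def (real t *\<^sub>R Le + X)" if "X \<in> F" "t \<in> {1..T}" for X t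
    using static_feasible_pos_def[OF Le] that by (auto simp: F_def)
  note term_nonneg = static_cost_terms_nonneg[OF W Z Le]
  have one: "trace (W ** matrix_inv (Le + X)) \<le> ?f X" if "X \<in> F" for X
  proof -
    have "trace (W ** matrix_inv (real 1 *\<^sub>R Le + X)) \<le> (\<Sum>t=1..T. trace (W ** matrix_inv (real t *\<^sub>R Le + X)))"
      using T that term_nonneg by (intro member_le_sum) (auto simp: F_def)
    then show ?thesis using that term_nonneg(1)[of X] by (simp add: static_cost_def F_def)
  qed
  have two: "trace (matrix_inv Z ** X) \<le> ?f X" if "X \<in> F" for X
    using that term_nonneg by (auto simp: static_cost_def F_def intro!: sum_nonneg)
  have "0 \<le> ?f X" if "X \<in> F" for X
    using two[OF that] term_nonneg(1)[of X] that by (simp add: F_def)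
  then have bdd: "bdd_below (?f ` F)" by (intro bdd_belowI2[of _ 0])
  have "mat 1 \<in> F"
    using pos_def_imp_pos_semidef[OF pos_def_mat_1] pos_def_add_pos_semidef[OF pos_def_mat_1 Le]
    by (simp add: F_def static_feasible_def add.commute)
  then have ne: "F \<noteq> {}" by blast
  have "\<exists>X\<in>F. ?f X < m + 1 / real (Suc n)" for n
    using cInf_lessD[of "?f ` F" "m + 1 / real (Suc n)"] ne by (auto simp: m_def)
  then obtain X where X: "\<And>n. X n \<in> F" "\<And>n. ?f (X n) < m + 1 / real (Suc n)" by metis
  have fX: "?f (X n) \<le> m + 1" for n
  proof -
    have "1 / real (Suc n) \<le> 1" by simp
    with X(2)[of n] show ?thesis by linarith
  qed
  have "\<exists>b. \<forall>n. norm (X n) \<le> b"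
  proof -
    from generalized_rayleigh[OF transpose_mat pos_def_matrix_inv[OF Z] subspace_UNIV UNIV_not_singleton]
    obtain v :: "real^'n" and \<mu> where v: "v \<noteq> 0"
      and le: "\<forall>z\<in>UNIV. z \<bullet> (mat 1 *v z) \<le> \<mu> * (z \<bullet> (matrix_inv Z *v z))" by blast
    have \<mu>: "z \<bullet> z \<le> \<mu> * (z \<bullet> (matrix_inv Z *v z))" for z using le by simp
    have "0 < \<mu>"
    proof -
      have "0 < v \<bullet> v" "0 < v \<bullet> (matrix_inv Z *v v)"
        using v pos_def_matrix_inv[OF Z] by (simp_all add: pos_def_def)
      moreover from this \<mu>[of v] have "0 < \<mu> * (v \<bullet> (matrix_inv Z *v v))" by linarith
      ultimately show ?thesis by (simp add: zero_less_mult_iff)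
    qed
    have psd: "pos_semidef (\<mu> *\<^sub>R matrix_inv Z - mat 1)"
      using \<mu> pos_def_matrix_inv[OF Z]
      by (simp add: pos_semidef_def pos_def_def transpose_diff transpose_scalar
          matrix_vector_mult_diff_rdistrib matrix_vector_scaleR_left inner_diff_right)
    have "norm (X n) \<le> real (CARD('n) * CARD('n)) * (\<mu> * (m + 1))" for n
    proof -
      have psdX: "pos_semidef (X n)" using X(1) by (simp add: F_def static_feasible_def)
      have "0 \<le> trace ((\<mu> *\<^sub>R matrix_inv Z - mat 1) ** X n)"
        by (rule trace_mult_nonneg[OF psd psdX])
      then have "trace (X n) \<le> \<mu> * trace (matrix_inv Z ** X n)"
        by (simp add: matrix_diff_rdistrib matrix_scaleR_left trace_sub trace_scaleR)
      also have "\<dots> \<le> \<mu> * (m + 1)"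
        using two[OF X(1)[of n]] fX[of n] \<open>0 < \<mu>\<close> by (intro mult_left_mono) auto
      finally show ?thesis
        by (intro order_trans[OF pos_semidef_norm_le_trace[OF psdX]] mult_left_mono) simp_all
    qed
    then show ?thesis by blast
  qed
  then have "bounded (range X)" by (auto simp: bounded_iff)
  then obtain A r where r: "strict_mono r" and lim: "(X \<circ> r) \<longlonglongrightarrow> A"
    using bounded_imp_convergent_subsequence by blast
  define Y where "Y = X \<circ> r"
  have Y: "Y n \<in> F" "?f (Y n) \<le> m + 1" for n using X(1) fX by (simp_all add: Y_def)
  have limY: "Y \<longlonglongrightarrow> A" using lim by (simp add: Y_def)
  have "(\<lambda>n. m + 1 / real (Suc n)) \<longlonglongrightarrow> m + 0"
    by (intro tendsto_intros LIMSEQ_Suc[OF lim_1_over_n])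
  from LIMSEQ_subseq_LIMSEQ[OF this r]
  have mlim: "(\<lambda>n. m + 1 / real (Suc (r n))) \<longlonglongrightarrow> m" by (simp only: o_def add_0_right)
  have psdA: "pos_semidef A"
    by (rule pos_semidef_limit[OF _ limY]) (use Y(1) in \<open>simp add: F_def static_feasible_def\<close>)
  have limL: "(\<lambda>n. Le + Y n) \<longlonglongrightarrow> Le + A" by (intro tendsto_intros limY)
  have "0 < x \<bullet> ((Le + A) *v x)" if "x \<noteq> 0" for x
  proof (rule ccontr)
    assume "\<not> 0 < x \<bullet> ((Le + A) *v x)"
    then have zero: "x \<bullet> ((Le + A) *v x) = 0"
      using pos_semidef_add[OF Le psdA] by (auto simp: pos_semidef_def intro: order_antisym)
    let ?w = "x \<bullet> (W *v x)"
    have w: "0 < ?w" using W that by (simp add: pos_def_def)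
    \<comment> \<open>The minorants at a null vector \<open>x\<close> of the limit tend to \<open>2 s w\<close>; this \<open>s\<close> makes that \<open>m + 2\<close>,
      above the bound \<open>m + 1\<close> for the whole sequence.\<close>
    define s where "s = (m + 2) / (2 * ?w)"
    have "2 * s * ?w - s\<^sup>2 * ?w * (x \<bullet> ((Le + Y n) *v x)) \<le> m + 1" for n
    proof -
      have "pos_def (Le + Y n)" using Y(1)[of n] by (simp add: F_def static_feasible_def)
      from inverse_minorant_le[OF W this, of "s *\<^sub>R outer_self x"] show ?thesis
        using one[OF Y(1)[of n]] Y(2)[of n] by (simp add: inverse_minorant_outer_self)
    qed
    moreover have "(\<lambda>n. 2 * s * ?w - s\<^sup>2 * ?w * (x \<bullet> ((Le + Y n) *v x)))
        \<longlonglongrightarrow> 2 * s * ?w - s\<^sup>2 * ?w * (x \<bullet> ((Le + A) *v x))"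
      by (intro tendsto_intros tendsto_linear_matrix[OF linear_quadratic_form limL])
    ultimately have "2 * s * ?w \<le> m + 1"
      using zero by (intro LIMSEQ_le_const2) auto
    then show False using w by (simp add: s_def)
  qed
  then have "pos_def (Le + A)"
    using pos_semidef_add[OF Le psdA] by (simp add: pos_semidef_def pos_def_def)
  then have A: "A \<in> F" using psdA by (simp add: F_def static_feasible_def)
  \<comment> \<open>The inverses are taken at the limit and stay fixed along the sequence.\<close>
  let ?P = "\<lambda>t. matrix_inv (real t *\<^sub>R Le + A)"
  let ?g = "\<lambda>X. (\<Sum>t=1..T. inverse_minorant W (?P t) (real t *\<^sub>R Le + X)) + trace (matrix_inv Z ** X)"
  have "(\<lambda>n. ?g (Y n)) \<longlonglongrightarrow> ?g A"
    unfolding inverse_minorant_def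
    by (intro tendsto_intros tendsto_linear_matrix[OF linear_trace_mult] limY)
  moreover have "?g (Y n) \<le> m + 1 / real (Suc (r n))" for n
  proof -
    have "?g (Y n) \<le> ?f (Y n)"
      unfolding static_cost_def using pd[OF Y(1)]
      by (intro add_right_mono sum_mono inverse_minorant_le W)
    with X(2)[of "r n"] show ?thesis by (simp add: Y_def)
  qed
  ultimately have "?g A \<le> m" using mlim by (intro LIMSEQ_le) auto
  moreover have "?g A = ?f A"
    unfolding static_cost_def using inverse_minorant_at_inverse[OF W pd[OF A]]
    by (intro arg_cong2[where f = "(+)"] sum.cong refl)
  moreover have "m \<le> ?f B" if "static_feasible Le B" for B
    unfolding m_def using that bdd by (intro cINF_lower) (simp_all add: F_def)
  ultimately have "?f A \<le> ?f B" if "static_feasible Le B" for B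
    using that by fastforce
  with A have "static_optimal W Z Le T A" by (simp add: static_optimal_def F_def)
  then show ?thesis ..
qed

lemma optimal_iff_static_optimal:
  fixes W Z Le :: "real^'n^'n"
  assumes W: "pos_def W" and Le: "pos_semidef Le" and T: "1 \<le> T"
  shows "optimal W Z Le T L \<longleftrightarrow> (\<forall>t\<in>{2..T}. L t = 0) \<and> static_optimal W Z Le T (L 1)"
proof -
  define single where "single X = (\<lambda>t::nat. if t = 1 then X else 0)" for X :: "real^'n^'n"
  have single: "cost W Z Le T (single X) = static_cost W Z Le T X"
    "feasible Le T (single X) \<longleftrightarrow> static_feasible Le X" for X
    using cost_eq_static_cost[OF _ T, of "single X"] feasible_iff_static_feasible[OF _ T, of "single X"]
    by (simp_all add: single_def)
  note static = cost_ge_static_cost[OF W Le T]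
  show ?thesis
  proof (intro iffI conjI)
    assume opt: "optimal W Z Le T L"
    then have L: "feasible Le T L" by (simp add: optimal_def)
    have "cost W Z Le T L \<le> static_cost W Z Le T (\<Sum>k=1..T. L k)"
      using opt static(1)[OF L] single by (metis optimal_def)
    then show zero: "\<forall>t\<in>{2..T}. L t = 0"
      using static(2,3)[OF L] by (metis order_antisym)
    show "static_optimal W Z Le T (L 1)"
      unfolding static_optimal_def
      using opt L single cost_eq_static_cost[OF zero T] feasible_iff_static_feasible[OF zero T]
      by (metis optimal_def)
  next
    assume "(\<forall>t\<in>{2..T}. L t = 0) \<and> static_optimal W Z Le T (L 1)"
    then have zero: "\<forall>t\<in>{2..T}. L t = 0" and opt: "static_optimal W Z Le T (L 1)" by auto
    show "optimal W Z Le T L"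
      unfolding optimal_def cost_eq_static_cost[OF zero T] feasible_iff_static_feasible[OF zero T]
      using opt static(1,2) by (meson order_trans static_optimal_def)
  qed
qed

lemma regret_eq_static_cost:
  assumes W: "pos_def W" and Le: "pos_semidef Le" and T: "1 \<le> T" and X: "static_optimal W Z Le T X"
  shows "regret W Z Le T = static_cost W Z Le T X"
proof -
  define L where "L = (\<lambda>t::nat. if t = 1 then X else 0)"
  have L: "optimal W Z Le T L"
    using optimal_iff_static_optimal[OF W Le T] X by (simp add: L_def)
  have "cost W Z Le T L = static_cost W Z Le T X"
    using cost_eq_static_cost[OF _ T, of L] by (simp add: L_def)
  moreover have "regret W Z Le T = cost W Z Le T L"
    unfolding regret_def using L by (intro cInf_eq_minimum) (auto simp: optimal_def)
  ultimately show ?thesis by simp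
qed

section \<open>Positive definite noise information\<close>

text \<open>Eigenvectors of the pencil for different eigenvalues are orthogonal for the inner product of
  \<open>M\<close>, so their images under the square root of \<open>M\<close> are orthogonal and there are only finitely
  many. The largest eigenvalue is a \<open>Max\<close>, which is meaningful for finite sets only.\<close>

lemma pencil_eigenvalues_finite:
  fixes M Q :: "real^'n^'n"
  assumes M: "pos_def M" and Q: "transpose Q = Q"
  shows "finite {\<mu>. \<exists>v. v \<noteq> 0 \<and> Q *v v = \<mu> *\<^sub>R (M *v v)}" (is "finite ?E")
proof -
  let ?V = "psd_sqrt M"
  note V = pos_def_psd_sqrt[OF M] psd_sqrt_works(2)[OF pos_def_imp_pos_semidef[OF M]]
  have Vsym: "transpose ?V = ?V" using V(1) by (simp add: pos_def_def)
  have VV: "(?V *v x) \<bullet> (?V *v y) = x \<bullet> (M *v y)" for x y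
    using dot_symmetric_matrix[OF Vsym, of x "?V *v y"] V(2)
    by (simp add: matrix_vector_mul_assoc inner_commute)
  have "\<forall>\<mu>\<in>?E. \<exists>v. v \<noteq> 0 \<and> Q *v v = \<mu> *\<^sub>R (M *v v)" by blast
  from bchoice[OF this]
  obtain u where u: "\<And>\<mu>. \<mu> \<in> ?E \<Longrightarrow> u \<mu> \<noteq> 0" "\<And>\<mu>. \<mu> \<in> ?E \<Longrightarrow> Q *v u \<mu> = \<mu> *\<^sub>R (M *v u \<mu>)"
    by blast
  have orth: "(?V *v u \<mu>) \<bullet> (?V *v u \<nu>) = 0" if "\<mu> \<in> ?E" "\<nu> \<in> ?E" "\<mu> \<noteq> \<nu>" for \<mu> \<nu>
  proof -
    have "u \<mu> \<bullet> (Q *v u \<nu>) = u \<nu> \<bullet> (Q *v u \<mu>)" by (rule dot_symmetric_matrix[OF Q])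
    then have "\<nu> * (u \<mu> \<bullet> (M *v u \<nu>)) = \<mu> * (u \<mu> \<bullet> (M *v u \<nu>))"
      using u(2) that dot_symmetric_matrix[of M "u \<mu>" "u \<nu>"] M by (simp add: pos_def_def)
    then show ?thesis using that(3) by (simp add: VV)
  qed
  have nz: "?V *v u \<mu> \<noteq> 0" if "\<mu> \<in> ?E" for \<mu> using u(1)[OF that] pos_def_kernel[OF V(1)] by blast
  have "inj_on (\<lambda>\<mu>. ?V *v u \<mu>) ?E"
  proof (intro inj_onI, rule ccontr)
    fix \<mu> \<nu> assume *: "\<mu> \<in> ?E" "\<nu> \<in> ?E" "?V *v u \<mu> = ?V *v u \<nu>" "\<mu> \<noteq> \<nu>"
    then show False using orth[OF *(1,2,4)] nz[OF *(1)] by simp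
  qed
  moreover have "finite ((\<lambda>\<mu>. ?V *v u \<mu>) ` ?E)"
    using orth by (intro pairwise_orthogonal_imp_finite) (auto simp: pairwise_def orthogonal_def)
  ultimately show ?thesis using finite_imageD by blast
qed

text \<open>The equation \<open>Z Q v = \<mu> v\<close> means \<open>Q v = \<mu> Z\<^sup>-\<^sup>1 v\<close>, so the largest eigenvalue is the maximum of the
  generalized Rayleigh quotient of \<open>Q\<close> and \<open>Z\<^sup>-\<^sup>1\<close>.\<close>

lemma lambda_max_pencil:
  fixes Z Q :: "real^'n^'n"
  assumes Z: "pos_def Z" and Q: "pos_def Q"
  defines "\<mu> \<equiv> lambda_max (Z ** Q)"
  shows "0 < \<mu>" and "z \<bullet> (Q *v z) \<le> \<mu> * (z \<bullet> (matrix_inv Z *v z))"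
    and "\<exists>v. v \<noteq> 0 \<and> v \<bullet> (Q *v v) = \<mu> * (v \<bullet> (matrix_inv Z *v v))"
proof -
  let ?M = "matrix_inv Z"
  have M: "pos_def ?M" by (rule pos_def_matrix_inv[OF Z])
  have Qsym: "transpose Q = Q" using Q by (simp add: pos_def_def)
  have eig: "(Z ** Q) *v v = \<nu> *\<^sub>R v \<longleftrightarrow> Q *v v = \<nu> *\<^sub>R (?M *v v)" for v \<nu>
  proof -
    have "Z *v (\<nu> *\<^sub>R (?M *v v)) = \<nu> *\<^sub>R v"
      by (simp add: matrix_vector_mult_scaleR pos_def_inverse_mult[OF Z])
    then have "(Z ** Q) *v v = \<nu> *\<^sub>R v \<longleftrightarrow> Z *v (Q *v v) = Z *v (\<nu> *\<^sub>R (?M *v v))"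
      by (simp only: matrix_vector_mul_assoc[symmetric])
    also have "\<dots> \<longleftrightarrow> Q *v v = \<nu> *\<^sub>R (?M *v v)"
      using pos_def_inverse_mult(2)[OF Z] by metis
    finally show ?thesis .
  qed
  have E: "eigenvalues (Z ** Q) = {\<nu>. \<exists>v. v \<noteq> 0 \<and> Q *v v = \<nu> *\<^sub>R (?M *v v)}"
    by (simp add: eigenvalues_def eig)
  from generalized_rayleigh[OF Qsym M subspace_UNIV UNIV_not_singleton]
  obtain v \<kappa> where v: "v \<noteq> 0"
    and "\<forall>z\<in>UNIV. z \<bullet> (Q *v z) \<le> \<kappa> * (z \<bullet> (?M *v z))"
    and "\<forall>z\<in>UNIV. z \<bullet> (Q *v v) = \<kappa> * (z \<bullet> (?M *v v))" by blast
  then have max: "z \<bullet> (Q *v z) \<le> \<kappa> * (z \<bullet> (?M *v z))"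
    and crit: "z \<bullet> (Q *v v) = \<kappa> * (z \<bullet> (?M *v v))" for z by simp_all
  have Qv: "Q *v v = \<kappa> *\<^sub>R (?M *v v)"
    by (rule vector_eq_ldot[THEN iffD1]) (simp add: crit)
  have "\<kappa> \<in> eigenvalues (Z ** Q)"
    unfolding E mem_Collect_eq by (rule exI[of _ v]) (rule conjI[OF v Qv])
  moreover have "\<nu> \<le> \<kappa>" if \<nu>: "\<nu> \<in> eigenvalues (Z ** Q)" for \<nu>
  proof -
    obtain w where w: "w \<noteq> 0" "Q *v w = \<nu> *\<^sub>R (?M *v w)" using \<nu> unfolding E by blast
    then have "\<nu> * (w \<bullet> (?M *v w)) \<le> \<kappa> * (w \<bullet> (?M *v w))" using max[of w] by simp
    moreover have "0 < w \<bullet> (?M *v w)" using M w(1) by (simp add: pos_def_def)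
    ultimately show ?thesis by simp
  qed
  moreover have "finite (eigenvalues (Z ** Q))"
    unfolding E by (rule pencil_eigenvalues_finite[OF M Qsym])
  ultimately have \<mu>: "\<mu> = \<kappa>" unfolding \<mu>_def lambda_max_def by (intro Max_eqI) auto
  show "z \<bullet> (Q *v z) \<le> \<mu> * (z \<bullet> (?M *v z))" using max \<mu> by blast
  have eq: "v \<bullet> (Q *v v) = \<mu> * (v \<bullet> (?M *v v))" using crit \<mu> by blast
  with v show "\<exists>v. v \<noteq> 0 \<and> v \<bullet> (Q *v v) = \<mu> * (v \<bullet> (?M *v v))" by blast
  have "0 < v \<bullet> (Q *v v)" "0 < v \<bullet> (?M *v v)" using Q M v by (simp_all add: pos_def_def)
  then show "0 < \<mu>" unfolding eq by (simp add: zero_less_mult_iff)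
qed

lemma matrix_inv_scaleR: "c \<noteq> 0 \<Longrightarrow> pos_def A \<Longrightarrow> matrix_inv (c *\<^sub>R A) = (1 / c) *\<^sub>R matrix_inv A"
  by (rule matrix_inv_unique) (simp add: matrix_scaleR_left matrix_scaleR_right pos_def_inverse)

lemma static_cost_zero:
  assumes "pos_def Le"
  shows "static_cost W Z Le T 0 = trace (matrix_inv Le ** W) * (\<Sum>t=1..T. 1 / real t)"
proof -
  have "trace (W ** matrix_inv (real t *\<^sub>R Le + 0)) = trace (matrix_inv Le ** W) * (1 / real t)"
    if "t \<in> {1..T}" for t
    using that trace_mul_sym[of W "matrix_inv Le"]
    by (simp add: matrix_inv_scaleR[OF _ assms] matrix_scaleR_right trace_scaleR)
  then show ?thesis by (simp add: static_cost_def trace_zero sum_distrib_left)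
qed

text \<open>The minorants for \<open>P\<^sub>t = (c / t) L\<^sub>e\<^sup>-\<^sup>1\<close> sum to the left-hand side minus
  \<open>c\<^sup>2 (\<Sum>t\<le>T. 1/t\<^sup>2) tr (Q X)\<close> with \<open>Q = L\<^sub>e\<^sup>-\<^sup>1 W L\<^sub>e\<^sup>-\<^sup>1\<close>, and the condition on \<open>c\<close> says precisely that the
  price \<open>tr (Z\<^sup>-\<^sup>1 X)\<close> makes up for this loss.\<close>

lemma static_cost_ge_scaled:
  assumes W: "pos_def W" and Z: "pos_def Z" and Le: "pos_def Le" and X: "static_feasible Le X"
    and c: "c\<^sup>2 * (lambda_max (Z ** (matrix_inv Le ** W ** matrix_inv Le)) * (\<Sum>t=1..T. 1 / (real t)\<^sup>2)) \<le> 1"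
  shows "(2 - c) * c * trace (matrix_inv Le ** W) * (\<Sum>t=1..T. 1 / real t) \<le> static_cost W Z Le T X"
proof -
  let ?I = "matrix_inv Le"
  let ?Q = "?I ** W ** ?I"
  let ?H = "\<Sum>t=1..T. 1 / real t" and ?H2 = "\<Sum>t=1..T. 1 / (real t)\<^sup>2"
  let ?\<tau> = "trace (?I ** W)"
  define \<mu> where "\<mu> = lambda_max (Z ** ?Q)"
  have Q: "pos_def ?Q" by (rule pos_def_symmetric_congruence[OF W pos_def_matrix_inv[OF Le]])
  have I: "transpose ?I = ?I" using pos_def_matrix_inv[OF Le] by (simp add: pos_def_def)
  have M: "pos_def (matrix_inv Z)" by (rule pos_def_matrix_inv[OF Z])
  have minorant: "inverse_minorant W ((c / real t) *\<^sub>R ?I) (real t *\<^sub>R Le + X) =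
      (2 - c) * c * ?\<tau> * (1 / real t) - c\<^sup>2 * trace (?Q ** X) * (1 / (real t)\<^sup>2)"
    if "t \<in> {1..T}" for t
  proof -
    have "trace (?Q ** Le) = ?\<tau>" by (simp add: pos_def_inverse[OF Le] flip: matrix_mul_assoc)
    moreover have "trace (W ** ?I) = ?\<tau>" by (rule trace_mul_sym)
    ultimately show ?thesis using that
      by (simp add: inverse_minorant_def transpose_scalar I matrix_scaleR_left matrix_scaleR_right
          matrix_add_ldistrib trace_add trace_scaleR field_simps power2_eq_square)
  qed
  have "pos_semidef (matrix_inv Z - (c\<^sup>2 * ?H2) *\<^sub>R ?Q)"
    unfolding pos_semidef_def
  proof (intro conjI allI)
    show "transpose (matrix_inv Z - (c\<^sup>2 * ?H2) *\<^sub>R ?Q) = matrix_inv Z - (c\<^sup>2 * ?H2) *\<^sub>R ?Q"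
      using M Q by (simp add: pos_def_def transpose_diff transpose_scalar)
    fix x :: "real^'a"
    have nonneg: "0 \<le> x \<bullet> (matrix_inv Z *v x)"
      using pos_def_imp_pos_semidef[OF M] by (simp add: pos_semidef_def)
    have "(c\<^sup>2 * ?H2) * (x \<bullet> (?Q *v x)) \<le> (c\<^sup>2 * ?H2) * (\<mu> * (x \<bullet> (matrix_inv Z *v x)))"
      using lambda_max_pencil(2)[OF Z Q, of x] unfolding \<mu>_def
      by (intro mult_left_mono mult_nonneg_nonneg sum_nonneg) auto
    also have "\<dots> = (c\<^sup>2 * (\<mu> * ?H2)) * (x \<bullet> (matrix_inv Z *v x))" by (simp add: ac_simps)
    also have "\<dots> \<le> 1 * (x \<bullet> (matrix_inv Z *v x))"
      using c unfolding \<mu>_def by (intro mult_right_mono nonneg)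
    finally show "0 \<le> x \<bullet> ((matrix_inv Z - (c\<^sup>2 * ?H2) *\<^sub>R ?Q) *v x)"
      by (simp add: matrix_vector_mult_diff_rdistrib matrix_vector_scaleR_left inner_diff_right)
  qed
  then have "0 \<le> trace ((matrix_inv Z - (c\<^sup>2 * ?H2) *\<^sub>R ?Q) ** X)"
    using X by (intro trace_mult_nonneg) (simp_all add: static_feasible_def)
  then have pay: "c\<^sup>2 * ?H2 * trace (?Q ** X) \<le> trace (matrix_inv Z ** X)"
    by (simp add: matrix_diff_rdistrib matrix_scaleR_left trace_sub trace_scaleR)
  have "(2 - c) * c * ?\<tau> * ?H - c\<^sup>2 * trace (?Q ** X) * ?H2
      = (\<Sum>t=1..T. inverse_minorant W ((c / real t) *\<^sub>R ?I) (real t *\<^sub>R Le + X))"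
    unfolding sum_distrib_left sum_subtractf[symmetric] using minorant by (intro sum.cong refl) simp
  also have "\<dots> \<le> (\<Sum>t=1..T. trace (W ** matrix_inv (real t *\<^sub>R Le + X)))"
    by (intro sum_mono inverse_minorant_le W static_feasible_pos_def pos_def_imp_pos_semidef Le X) auto
  finally show ?thesis using pay by (simp add: static_cost_def algebra_simps)
qed

text \<open>The part of the Sherman-Morrison formula that is needed: \<open>A + s v v\<^sup>T\<close> maps \<open>A\<^sup>-\<^sup>1 v\<close> to a multiple of
  \<open>v\<close>.\<close>

lemma rank_one_inverse_mult:
  assumes A: "pos_def A" and B: "pos_def (A + s *\<^sub>R outer_self v)" and "0 \<le> s"
  shows "matrix_inv (A + s *\<^sub>R outer_self v) *v v =
    (1 / (1 + s * (v \<bullet> (matrix_inv A *v v)))) *\<^sub>R (matrix_inv A *v v)"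
proof -
  let ?B = "A + s *\<^sub>R outer_self v" and ?u = "matrix_inv A *v v"
  let ?d = "1 + s * (v \<bullet> ?u)"
  have "0 \<le> v \<bullet> ?u"
    using pos_def_imp_pos_semidef[OF pos_def_matrix_inv[OF A]] by (simp add: pos_semidef_def)
  then have d: "?d \<noteq> 0" using \<open>0 \<le> s\<close> by (smt (verit) mult_nonneg_nonneg)
  have "?B *v ?u = ?d *\<^sub>R v"
    by (simp add: matrix_vector_mult_add_rdistrib pos_def_inverse_mult[OF A]
        matrix_vector_scaleR_left outer_self_mult algebra_simps)
  then have "?d *\<^sub>R (matrix_inv ?B *v v) = ?u"
    using pos_def_inverse_mult(2)[OF B, of ?u] by (simp add: matrix_vector_mult_scaleR)
  then have "(1 / ?d) *\<^sub>R (?d *\<^sub>R (matrix_inv ?B *v v)) = (1 / ?d) *\<^sub>R ?u" by (rule arg_cong)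
  then show ?thesis using d by simp
qed

text \<open>Optimality of zero is tested with \<open>s v v\<^sup>T\<close> for a top eigenvector \<open>v\<close>. The information cost falls by
  at least \<open>s \<mu> z (\<Sum>t\<le>T. 1/(t + s a)\<^sup>2)\<close>, the price rises by \<open>s z\<close>, where
  \<open>z = v \<bullet> Z\<^sup>-\<^sup>1 v\<close> and \<open>a = v \<bullet> L\<^sub>e\<^sup>-\<^sup>1 v\<close>; it remains to let \<open>s\<close> tend to zero.\<close>

lemma static_optimal_zero_imp:
  assumes W: "pos_def W" and Z: "pos_def Z" and Le: "pos_def Le"
    and opt: "static_optimal W Z Le T 0"
  shows "lambda_max (Z ** (matrix_inv Le ** W ** matrix_inv Le)) * (\<Sum>t=1..T. 1 / (real t)\<^sup>2) \<le> 1"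
proof -
  let ?I = "matrix_inv Le"
  let ?Q = "?I ** W ** ?I"
  define \<mu> where "\<mu> = lambda_max (Z ** ?Q)"
  have Q: "pos_def ?Q" by (rule pos_def_symmetric_congruence[OF W pos_def_matrix_inv[OF Le]])
  obtain v where v: "v \<noteq> 0" "v \<bullet> (?Q *v v) = \<mu> * (v \<bullet> (matrix_inv Z *v v))"
    using lambda_max_pencil(3)[OF Z Q] unfolding \<mu>_def by blast
  let ?a = "v \<bullet> (?I *v v)" and ?z = "v \<bullet> (matrix_inv Z *v v)"
  have z: "0 < ?z" using pos_def_matrix_inv[OF Z] v(1) by (simp add: pos_def_def)
  have a: "0 \<le> ?a"
    using pos_def_imp_pos_semidef[OF pos_def_matrix_inv[OF Le]] by (simp add: pos_semidef_def)
  have bound: "\<mu> * (\<Sum>t=1..T. 1 / (real t + s * ?a)\<^sup>2) \<le> 1" if s: "0 < s" for s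
  proof -
    let ?Y = "s *\<^sub>R outer_self v"
    have "pos_semidef ?Y" using s by (intro pos_semidef_scaleR pos_semidef_outer_self) simp
    then have Y: "static_feasible Le ?Y"
      using pos_def_add_pos_semidef[OF Le] by (simp add: static_feasible_def)
    have step: "trace (W ** matrix_inv (real t *\<^sub>R Le + ?Y)) + s * (\<mu> * ?z * (1 / (real t + s * ?a)\<^sup>2))
        \<le> trace (W ** matrix_inv (real t *\<^sub>R Le + 0))" if t: "t \<in> {1..T}" for t
    proof -
      let ?A = "real t *\<^sub>R Le"
      let ?B = "?A + ?Y"
      have A: "pos_def ?A" using Le t by (intro pos_def_scaleR) auto
      have B: "pos_def ?B" using pos_def_add_pos_semidef[OF A] Y by (simp add: static_feasible_def)
      have Bsym: "transpose (matrix_inv ?B) = matrix_inv ?B"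
        using pos_def_matrix_inv[OF B] by (simp add: pos_def_def)
      have Isym: "transpose ?I = ?I" using pos_def_matrix_inv[OF Le] by (simp add: pos_def_def)
      have "matrix_inv ?B *v v = (1 / (1 + s * (?a / real t))) *\<^sub>R ((1 / real t) *\<^sub>R (?I *v v))"
        using t s rank_one_inverse_mult[OF A B]
        by (simp add: matrix_inv_scaleR[OF _ Le] matrix_vector_scaleR_left)
      also have "\<dots> = (1 / (real t + s * ?a)) *\<^sub>R (?I *v v)"
        using t by (simp add: field_simps)
      finally have Bv: "matrix_inv ?B *v v = (1 / (real t + s * ?a)) *\<^sub>R (?I *v v)" .
      have "trace (matrix_inv ?B ** W ** matrix_inv ?B ** (?B - ?A))
          = s * (v \<bullet> ((transpose (matrix_inv ?B) ** W ** matrix_inv ?B) *v v))"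
        by (simp add: matrix_scaleR_right trace_scaleR trace_outer_self Bsym)
      also have "\<dots> = s * ((1 / (real t + s * ?a))\<^sup>2 * (v \<bullet> ((transpose ?I ** W ** ?I) *v v)))"
        unfolding quadratic_form_congruence
        by (simp add: Bv matrix_vector_mult_scaleR power2_eq_square)
      also have "\<dots> = s * (\<mu> * ?z * (1 / (real t + s * ?a)\<^sup>2))"
        using v(2) by (simp add: Isym power_divide)
      finally show ?thesis using trace_inverse_increment[OF W A B] by simp
    qed
    have "(\<Sum>t=1..T. trace (W ** matrix_inv (real t *\<^sub>R Le + ?Y)))
        + s * (\<mu> * ?z * (\<Sum>t=1..T. 1 / (real t + s * ?a)\<^sup>2))
        = (\<Sum>t=1..T. trace (W ** matrix_inv (real t *\<^sub>R Le + ?Y)) + s * (\<mu> * ?z * (1 / (real t + s * ?a)\<^sup>2)))"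
      by (simp add: sum.distrib sum_distrib_left)
    also have "\<dots> \<le> (\<Sum>t=1..T. trace (W ** matrix_inv (real t *\<^sub>R Le + 0)))"
      by (intro sum_mono step)
    also have "\<dots> = static_cost W Z Le T 0" by (simp add: static_cost_def trace_zero)
    also have "\<dots> \<le> static_cost W Z Le T ?Y"
      using opt Y by (simp add: static_optimal_def)
    also have "\<dots> = (\<Sum>t=1..T. trace (W ** matrix_inv (real t *\<^sub>R Le + ?Y))) + s * ?z"
      by (simp add: static_cost_def matrix_scaleR_right trace_scaleR trace_outer_self)
    finally have "s * (\<mu> * ?z * (\<Sum>t=1..T. 1 / (real t + s * ?a)\<^sup>2)) \<le> s * ?z" by simp
    then have "?z * (\<mu> * (\<Sum>t=1..T. 1 / (real t + s * ?a)\<^sup>2)) \<le> ?z * 1"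
      using s by (simp add: ac_simps)
    then show ?thesis using z by (simp only: mult_le_cancel_left_pos)
  qed
  have "(\<lambda>n. \<mu> * (\<Sum>t=1..T. 1 / (real t + 1 / real (Suc n) * ?a)\<^sup>2))
      \<longlonglongrightarrow> \<mu> * (\<Sum>t=1..T. 1 / (real t + 0 * ?a)\<^sup>2)"
    by (intro tendsto_intros LIMSEQ_Suc[OF lim_1_over_n]) auto
  then have "\<mu> * (\<Sum>t=1..T. 1 / (real t + 0 * ?a)\<^sup>2) \<le> 1"
    by (rule LIMSEQ_le_const2) (intro exI allI impI bound, simp)
  then show ?thesis by (simp add: \<mu>_def)
qed

section \<open>Singular noise information\<close>

lemma orthonormal_family_inner:
  "orthonormal_family m v \<Longrightarrow> i \<in> {1..m} \<Longrightarrow> j \<in> {1..m} \<Longrightarrow> v i \<bullet> v j = (if i = j then 1 else 0)"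
  by (simp add: orthonormal_family_def)

lemma outer_sum_mult: "(\<Sum>k\<in>K. a k *\<^sub>R outer_self (v k)) *v x = (\<Sum>k\<in>K. (a k * (v k \<bullet> x)) *\<^sub>R v k)"
  by (simp add: matrix_vector_sum_left matrix_vector_scaleR_left outer_self_mult)

lemma orthonormal_outer_sum_mult:
  assumes "orthonormal_family m v" and j: "j \<in> {1..m}"
  shows "(\<Sum>k=1..m. a k *\<^sub>R outer_self (v k)) *v v j = a j *\<^sub>R v j"
proof -
  have "(\<Sum>k=1..m. (a k * (v k \<bullet> v j)) *\<^sub>R v k) = (\<Sum>k=1..m. if k = j then a j *\<^sub>R v j else 0)"
    using orthonormal_family_inner[OF assms(1) _ j] by (intro sum.cong) auto
  then show ?thesis using j by (simp add: outer_sum_mult)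
qed

lemma trace_mult_outer_sum:
  "trace (A ** (\<Sum>k\<in>K. a k *\<^sub>R outer_self (v k))) = (\<Sum>k\<in>K. a k * (v k \<bullet> (A *v v k)))"
  by (simp add: matrix_sum_right trace_sum matrix_scaleR_right trace_scaleR trace_outer_self)

lemma transpose_outer_sum:
  "transpose (\<Sum>k\<in>K. a k *\<^sub>R outer_self (v k)) = (\<Sum>k\<in>K. a k *\<^sub>R outer_self (v k))"
  by (simp add: transpose_sum transpose_scalar transpose_outer_self)

lemma pos_semidef_outer_sum:
  "(\<And>k. k \<in> K \<Longrightarrow> 0 \<le> a k) \<Longrightarrow> pos_semidef (\<Sum>k\<in>K. a k *\<^sub>R outer_self (v k))"
  by (intro pos_semidef_sum pos_semidef_scaleR pos_semidef_outer_self)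

lemma orthonormal_projection:
  assumes v: "orthonormal_family m v"
  defines "N \<equiv> \<Sum>k=1..m. outer_self (v k)"
  shows "N *v x = (\<Sum>k=1..m. (v k \<bullet> x) *\<^sub>R v k)" and "k \<in> {1..m} \<Longrightarrow> N *v v k = v k"
    and "N ** N = N" and "transpose N = N" and "pos_semidef (mat 1 - N)"
proof -
  have N: "N = (\<Sum>k=1..m. 1 *\<^sub>R outer_self (v k))" by (simp add: N_def)
  show sym: "transpose N = N" unfolding N by (rule transpose_outer_sum)
  show mult: "N *v x = (\<Sum>k=1..m. (v k \<bullet> x) *\<^sub>R v k)" for x
    unfolding N outer_sum_mult by simp
  have "N *v v k = 1 *\<^sub>R v k" if "k \<in> {1..m}" for k
    unfolding N by (rule orthonormal_outer_sum_mult[OF v that])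
  then show fix_v: "N *v v k = v k" if "k \<in> {1..m}" for k using that by simp
  have "N *v (N *v x) = N *v x" for x
  proof -
    have "N *v (N *v x) = (\<Sum>k=1..m. (v k \<bullet> x) *\<^sub>R (N *v v k))"
      unfolding mult[of x] by (simp only: matrix_vector_mul_linear linear_sum matrix_vector_mult_scaleR)
    also have "\<dots> = N *v x" unfolding mult[of x] using fix_v by (intro sum.cong refl) simp
    finally show ?thesis .
  qed
  then show idem: "N ** N = N" by (simp add: matrix_eq flip: matrix_vector_mul_assoc)
  have "pos_semidef (transpose (mat 1 - N) ** mat 1 ** (mat 1 - N))"
    by (rule pos_semidef_congruence[OF pos_def_imp_pos_semidef[OF pos_def_mat_1]])
  also have "transpose (mat 1 - N) ** mat 1 ** (mat 1 - N) = mat 1 - N"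
    by (simp add: transpose_diff sym matrix_diff_ldistrib matrix_diff_rdistrib idem)
  finally show "pos_semidef (mat 1 - N)" .
qed

lemma null_basis_kernel:
  assumes "orthonormal_null_basis S m v" and "k \<in> {1..m}"
  shows "S *v v k = 0"
proof -
  have "v k \<in> span (v ` {1..m})" using assms(2) by (intro span_base) simp
  then show ?thesis using assms(1) by (simp add: orthonormal_null_basis_def)
qed

text \<open>Subtracting from \<open>x\<close> its components along the \<open>e\<^sub>k\<close> leaves a vector that \<open>S\<close> annihilates, hence a
  combination of the \<open>v\<^sub>k\<close>; and the two families are orthogonal to each other because \<open>S\<close> is
  symmetric.\<close>

lemma null_basis_eigendecomposition_complete:
  assumes v: "orthonormal_null_basis S m v" and e: "eigendecomposition S r ev e"
  shows "(\<Sum>k=1..r. (e k \<bullet> x) *\<^sub>R e k) + (\<Sum>k=1..m. (v k \<bullet> x) *\<^sub>R v k) = x"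
proof -
  have oe: "orthonormal_family r e" and S: "S = (\<Sum>k=1..r. ev k *\<^sub>R outer_self (e k))"
    and ev: "\<And>k. k \<in> {1..r} \<Longrightarrow> ev k \<noteq> 0"
    using e by (auto simp: eigendecomposition_def)
  have ov: "orthonormal_family m v" using v by (simp add: orthonormal_null_basis_def)
  have Se: "S *v e k = ev k *\<^sub>R e k" if "k \<in> {1..r}" for k
    unfolding S by (rule orthonormal_outer_sum_mult[OF oe that])
  have "transpose S = S" unfolding S by (rule transpose_outer_sum)
  then have ve: "v j \<bullet> e k = 0" if "j \<in> {1..m}" "k \<in> {1..r}" for j k
    using dot_symmetric_matrix[of S "v j" "e k"] null_basis_kernel[OF v that(1)] Se[OF that(2)] ev[OF that(2)]
    by simp
  let ?p = "\<Sum>k=1..r. (e k \<bullet> x) *\<^sub>R e k"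
  have "S *v ?p = (\<Sum>k=1..r. (e k \<bullet> x) *\<^sub>R (S *v e k))"
    by (simp only: matrix_vector_mul_linear linear_sum matrix_vector_mult_scaleR)
  also have "\<dots> = S *v x"
    by (subst (2) S) (simp add: Se outer_sum_mult mult.commute)
  finally have "S *v (x - ?p) = 0" by (simp add: matrix_vector_mult_diff_distrib)
  then have "x - ?p \<in> span (v ` {1..m})" using v by (simp add: orthonormal_null_basis_def)
  moreover have "(\<Sum>k=1..m. outer_self (v k)) *v y = y" if "y \<in> span (v ` {1..m})" for y
    by (rule linear_eq_on_span[OF _ _ _ that, of _ "\<lambda>y. y"])
      (use orthonormal_projection(2)[OF ov] in \<open>auto simp: linear_id[unfolded id_def]\<close>)
  ultimately have "(\<Sum>k=1..m. outer_self (v k)) *v (x - ?p) = x - ?p" by blast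
  then have "x - ?p = (\<Sum>k=1..m. (v k \<bullet> (x - ?p)) *\<^sub>R v k)"
    unfolding orthonormal_projection(1)[OF ov] by (rule sym)
  also have "\<dots> = (\<Sum>k=1..m. (v k \<bullet> x) *\<^sub>R v k)"
    using ve by (intro sum.cong refl) (simp add: inner_diff_right inner_sum_right)
  finally show ?thesis by (simp add: algebra_simps)
qed

lemma sum_scaled_eigenvectors:
  fixes A :: "real^'n^'n"
  assumes "\<And>k. k \<in> K \<Longrightarrow> A *v u k = c k *\<^sub>R u k"
  shows "A *v (\<Sum>k\<in>K. b k *\<^sub>R u k) = (\<Sum>k\<in>K. (b k * c k) *\<^sub>R u k)"
proof -
  have "A *v (\<Sum>k\<in>K. b k *\<^sub>R u k) = (\<Sum>k\<in>K. b k *\<^sub>R (A *v u k))"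
    by (simp only: matrix_vector_mul_linear linear_sum matrix_vector_mult_scaleR)
  then show ?thesis using assms by simp
qed

text \<open>In the coordinates given by \<open>V\<close>, take \<open>P = N R\<^sup>-\<^sup>1 / \<surd>T\<close>, where \<open>N\<close> is the orthogonal projection onto the null
  space of \<open>S\<^sub>V\<close> and \<open>R\<close> the square root of \<open>W\<^sub>V\<close>. Then \<open>P W\<^sub>V P\<^sup>T = N / T\<close>, so the growing term \<open>t S\<^sub>V\<close>
  drops out of the minorant, and the loss summed over \<open>T\<close> steps is \<open>tr (N Y)\<close> with \<open>Y = V X V\<close>. This is
  at most the price \<open>tr Y\<close>.\<close>

lemma static_cost_ge_delta:
  assumes W: "pos_def W" and Z: "pos_def Z" and Le: "pos_semidef Le" and T: "1 \<le> T"
    and X: "static_feasible Le X"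
  defines "V \<equiv> pd_sqrt (matrix_inv Z)"
  assumes v: "orthonormal_null_basis (S_V V Le) m v"
  shows "delta_const (W_V V W) m v * sqrt (real T) \<le> static_cost W Z Le T X"
proof -
  have V: "pos_def V" and VV: "V ** V = matrix_inv Z"
    unfolding V_def using pd_sqrt_works pos_def_matrix_inv[OF Z] by blast+
  have Vsym: "transpose V = V" using V by (simp add: pos_def_def)
  define S where "S = S_V V Le"
  define Y where "Y = V ** X ** V"
  let ?U = "W_V V W"
  have U: "pos_def ?U"
    unfolding W_V_def by (rule pos_def_symmetric_congruence[OF W V])
  define R where "R = psd_sqrt ?U"
  have R: "pos_def R" and RR: "R ** R = ?U"
    unfolding R_def using pos_def_psd_sqrt[OF U] psd_sqrt_works(2)[OF pos_def_imp_pos_semidef[OF U]] by auto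
  have Rsym: "transpose (matrix_inv R) = matrix_inv R"
    using pos_def_matrix_inv[OF R] by (simp add: pos_def_def)
  define N where "N = (\<Sum>k=1..m. outer_self (v k))"
  have ov: "orthonormal_family m v" using v by (simp add: orthonormal_null_basis_def)
  note N_mult = orthonormal_projection(1)[OF ov, folded N_def]
    and idem = orthonormal_projection(3)[OF ov, folded N_def]
    and N_sym = orthonormal_projection(4)[OF ov, folded N_def]
    and N_psd = orthonormal_projection(5)[OF ov, folded N_def]
  have "S *v (N *v x) = 0" for x
    unfolding N_mult using sum_scaled_eigenvectors[of "{1..m}" S v "\<lambda>_. 0"] null_basis_kernel[OF v]
    by (simp add: S_def)
  then have SN: "S ** N = 0" by (simp add: matrix_eq flip: matrix_vector_mul_assoc)
  have RN: "2 * trace (R ** N) = delta_const ?U m v"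
    by (simp add: N_def matrix_sum_right trace_sum trace_outer_self delta_const_def R_def)
  let ?s = "1 / sqrt (real T)"
  have s: "?s * ?s = 1 / real T" "?s * real T = sqrt (real T)"
    using T by (simp_all add: real_div_sqrt)
  \<comment> \<open>The outer factors \<open>V\<close> translate \<open>N R\<^sup>-\<^sup>1 / \<surd>T\<close> back to the original coordinates.\<close>
  define P where "P = ?s *\<^sub>R (V ** N ** matrix_inv R ** V)"
  have minorant: "inverse_minorant W P (real t *\<^sub>R Le + X) = ?s * delta_const ?U m v - trace (N ** Y) / real T"
    for t
  proof -
    have "trace (W ** (V ** N ** matrix_inv R ** V)) = trace (V ** (W ** V ** N ** matrix_inv R))"
      using trace_mul_sym[of "W ** V ** N ** matrix_inv R" V] by (simp add: matrix_mul_assoc)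
    also have "\<dots> = trace (R ** R ** N ** matrix_inv R)"
      by (simp add: RR W_V_def matrix_mul_assoc)
    also have "\<dots> = trace (matrix_inv R ** (R ** R ** N))"
      by (rule trace_mul_sym)
    also have "\<dots> = trace (R ** N)"
      by (simp add: matrix_mul_assoc pos_def_inverse[OF R])
    finally have first: "2 * trace (W ** P) = ?s * delta_const ?U m v"
      by (simp add: P_def matrix_scaleR_right trace_scaleR flip: RN)
    have Pt: "transpose P = ?s *\<^sub>R (V ** matrix_inv R ** N ** V)"
      by (simp add: P_def transpose_scalar matrix_transpose_mul Vsym N_sym Rsym matrix_mul_assoc)
    have "P ** W ** transpose P = (1 / real T) *\<^sub>R (V ** N ** matrix_inv R ** ?U ** matrix_inv R ** N ** V)"
      unfolding Pt unfolding P_def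
      by (simp add: matrix_scaleR_left matrix_scaleR_right matrix_mul_assoc W_V_def s)
    also have "V ** N ** matrix_inv R ** ?U ** matrix_inv R ** N ** V
        = V ** N ** (matrix_inv R ** R) ** (R ** matrix_inv R) ** N ** V"
      by (simp only: RR[symmetric] matrix_mul_assoc)
    also have "\<dots> = V ** (N ** N) ** V"
      by (simp add: pos_def_inverse[OF R] matrix_mul_assoc)
    finally have "trace (P ** W ** transpose P ** (real t *\<^sub>R Le + X))
        = trace (V ** (N ** V ** (real t *\<^sub>R Le + X))) / real T"
      by (simp add: idem matrix_scaleR_left trace_scaleR matrix_mul_assoc)
    also have "trace (V ** (N ** V ** (real t *\<^sub>R Le + X))) = trace (N ** V ** (real t *\<^sub>R Le + X) ** V)"
      by (rule trace_mul_sym)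
    also have "\<dots> = real t * trace (N ** S) + trace (N ** Y)"
      by (simp add: S_def S_V_def Y_def matrix_add_ldistrib matrix_add_rdistrib matrix_scaleR_left
          matrix_scaleR_right trace_add trace_scaleR matrix_mul_assoc)
    also have "trace (N ** S) = 0" using trace_mul_sym[of N S] SN by (simp add: trace_zero)
    finally show ?thesis using first by (simp add: inverse_minorant_def)
  qed
  have "pos_semidef Y"
    using pos_semidef_congruence[of X V] X by (simp add: Y_def Vsym static_feasible_def)
  then have "0 \<le> trace ((mat 1 - N) ** Y)" by (rule trace_mult_nonneg[OF N_psd])
  then have pay: "trace (N ** Y) \<le> trace Y"
    by (simp add: matrix_diff_rdistrib trace_sub)
  have Y: "trace Y = trace (matrix_inv Z ** X)"
    using trace_mul_sym[of "V ** X" V] by (simp add: Y_def VV[symmetric] matrix_mul_assoc)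
  have "sqrt (real T) * delta_const ?U m v - trace (N ** Y)
      = (\<Sum>t=1..T. inverse_minorant W P (real t *\<^sub>R Le + X))"
    unfolding minorant using T s(2) by (simp add: field_simps)
  also have "\<dots> \<le> (\<Sum>t=1..T. trace (W ** matrix_inv (real t *\<^sub>R Le + X)))"
    by (intro sum_mono inverse_minorant_le W static_feasible_pos_def Le X) auto
  finally show ?thesis using pay Y by (simp add: static_cost_def mult.commute)
qed

text \<open>In the coordinates given by \<open>V\<close>, the excitation is \<open>Y = \<surd>T \<Sum>k. a\<^sub>k v\<^sub>k v\<^sub>k\<^sup>T\<close> with
  \<open>a\<^sub>k = v\<^sub>k \<bullet> R v\<^sub>k\<close> and \<open>R\<close> the square root of \<open>W\<^sub>V\<close>. Every \<open>t S\<^sub>V + Y\<close> is then diagonal in the orthonormal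
  basis formed by the \<open>e\<^sub>k\<close> and \<open>v\<^sub>k\<close>, so that its inverse and the cost are explicit.\<close>

lemma static_cost_le_chi_nu:
  assumes W: "pos_def W" and Z: "pos_def Z" and Le: "pos_semidef Le" and T: "1 \<le> T"
  defines "V \<equiv> pd_sqrt (matrix_inv Z)"
  assumes v: "orthonormal_null_basis (S_V V Le) m v" and e: "eigendecomposition (S_V V Le) r ev e"
  shows "\<exists>X. static_feasible Le X \<and>
    static_cost W Z Le T X = chi_const (W_V V W) m v * sqrt (real T) + nu_seq (W_V V W) r ev e T"
proof -
  have V: "pos_def V" and VV: "V ** V = matrix_inv Z"
    unfolding V_def using pd_sqrt_works pos_def_matrix_inv[OF Z] by blast+
  let ?I = "matrix_inv V"
  have I: "pos_def ?I" by (rule pos_def_matrix_inv[OF V])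
  have Isym: "transpose ?I = ?I" using I by (simp add: pos_def_def)
  define S where "S = S_V V Le"
  have Le_S: "Le = ?I ** S ** ?I"
  proof -
    have "?I ** S ** ?I = (?I ** V) ** Le ** (V ** ?I)" by (simp only: S_def S_V_def matrix_mul_assoc)
    then show ?thesis by (simp add: pos_def_inverse[OF V])
  qed
  let ?U = "W_V V W"
  have U: "pos_def ?U"
    unfolding W_V_def by (rule pos_def_symmetric_congruence[OF W V])
  define a where "a k = v k \<bullet> (psd_sqrt ?U *v v k)" for k
  have ov: "orthonormal_family m v" using v by (simp add: orthonormal_null_basis_def)
  have a: "0 < a k" if "k \<in> {1..m}" for k
    using pos_def_psd_sqrt[OF U] orthonormal_family_inner[OF ov that that]
    unfolding pos_def_def a_def by (metis inner_zero_left zero_neq_one)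
  have oe: "orthonormal_family r e" and Sdec: "S = (\<Sum>k=1..r. ev k *\<^sub>R outer_self (e k))"
    and ev: "\<And>k. k \<in> {1..r} \<Longrightarrow> ev k \<noteq> 0"
    using e by (auto simp: eigendecomposition_def S_def)
  have Se: "S *v e k = ev k *\<^sub>R e k" if "k \<in> {1..r}" for k
    unfolding Sdec by (rule orthonormal_outer_sum_mult[OF oe that])
  have Sv: "S *v v k = 0" if "k \<in> {1..m}" for k
    using null_basis_kernel[OF v that] by (simp add: S_def)
  have "transpose S = S" unfolding Sdec by (rule transpose_outer_sum)
  then have ve: "v j \<bullet> e k = 0" if "j \<in> {1..m}" "k \<in> {1..r}" for j k
    using dot_symmetric_matrix[of S "v j" "e k"] Sv[OF that(1)] Se[OF that(2)] ev[OF that(2)] by simp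
  let ?q = "sqrt (real T)"
  have q: "0 < ?q" using T by simp
  define Y where "Y = (\<Sum>k=1..m. (?q * a k) *\<^sub>R outer_self (v k))"
  have Yv: "Y *v v k = (?q * a k) *\<^sub>R v k" if "k \<in> {1..m}" for k
    unfolding Y_def by (rule orthonormal_outer_sum_mult[OF ov that])
  have Ye: "Y *v e k = 0" if "k \<in> {1..r}" for k
    unfolding Y_def outer_sum_mult using ve that by simp
  have psdY: "pos_semidef Y"
    unfolding Y_def using a q by (intro pos_semidef_outer_sum mult_nonneg_nonneg) (auto intro: less_imp_le)
  define X where "X = ?I ** Y ** ?I"
  \<comment> \<open>The inverse of \<open>t S + Y\<close>.\<close>
  define K where "K t = (\<Sum>k=1..r. (1 / (real t * ev k)) *\<^sub>R outer_self (e k))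
    + (\<Sum>k=1..m. (1 / (?q * a k)) *\<^sub>R outer_self (v k))" for t
  have K: "(real t *\<^sub>R S + Y) ** K t = mat 1" if "1 \<le> t" for t
  proof -
    let ?B = "real t *\<^sub>R S + Y"
    have Be: "?B *v e k = (real t * ev k) *\<^sub>R e k" if "k \<in> {1..r}" for k
      using Se[OF that] Ye[OF that] by (simp add: matrix_vector_mult_add_rdistrib matrix_vector_scaleR_left)
    have Bv: "?B *v v k = (?q * a k) *\<^sub>R v k" if "k \<in> {1..m}" for k
      using Sv[OF that] Yv[OF that] by (simp add: matrix_vector_mult_add_rdistrib matrix_vector_scaleR_left)
    have sum_e: "?B *v (\<Sum>k=1..r. b k *\<^sub>R e k) = (\<Sum>k=1..r. (b k * (real t * ev k)) *\<^sub>R e k)"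
      and sum_v: "?B *v (\<Sum>k=1..m. b k *\<^sub>R v k) = (\<Sum>k=1..m. (b k * (?q * a k)) *\<^sub>R v k)" for b
      by (rule sum_scaled_eigenvectors[OF Be] sum_scaled_eigenvectors[OF Bv], assumption)+
    have "?B *v (K t *v x) = x" for x
    proof -
      have "?B *v (K t *v x) = (\<Sum>k=1..r. ((1 / (real t * ev k) * (e k \<bullet> x)) * (real t * ev k)) *\<^sub>R e k)
          + (\<Sum>k=1..m. ((1 / (?q * a k) * (v k \<bullet> x)) * (?q * a k)) *\<^sub>R v k)"
        unfolding K_def matrix_vector_mult_add_rdistrib[of _ _ x] outer_sum_mult matrix_vector_right_distrib
          sum_e sum_v by (rule refl)
      also have "\<dots> = (\<Sum>k=1..r. (e k \<bullet> x) *\<^sub>R e k) + (\<Sum>k=1..m. (v k \<bullet> x) *\<^sub>R v k)"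
        using ev a q \<open>1 \<le> t\<close> by (intro arg_cong2[where f = "(+)"] sum.cong refl) (auto simp: less_imp_neq[symmetric])
      also have "\<dots> = x" by (rule null_basis_eigendecomposition_complete[OF v e])
      finally show ?thesis .
    qed
    then show ?thesis by (simp add: matrix_eq flip: matrix_vector_mul_assoc)
  qed
  have inv: "(real t *\<^sub>R Le + X) ** (V ** K t ** V) = mat 1" if "1 \<le> t" for t
  proof -
    have "(real t *\<^sub>R Le + X) ** (V ** K t ** V) = ?I ** (real t *\<^sub>R S + Y) ** (?I ** V) ** K t ** V"
      by (simp add: X_def Le_S matrix_add_ldistrib matrix_add_rdistrib matrix_scaleR_left
          matrix_scaleR_right matrix_mul_assoc)
    also have "\<dots> = ?I ** ((real t *\<^sub>R S + Y) ** K t) ** V"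
      by (simp add: pos_def_inverse[OF V] matrix_mul_assoc)
    finally show ?thesis by (simp add: K[OF that] pos_def_inverse[OF V])
  qed
  have psdX: "pos_semidef X"
    using pos_semidef_congruence[OF psdY, of ?I] by (simp add: X_def Isym)
  have feas: "static_feasible Le X"
    using psdX pos_semidef_invertible_imp_pos_def[OF pos_semidef_add[OF Le psdX], of "V ** K 1 ** V"] inv[of 1]
    by (simp add: static_feasible_def)
  let ?ne = "\<Sum>k=1..r. (e k \<bullet> (?U *v e k)) / ev k" and ?nv = "\<Sum>k=1..m. (v k \<bullet> (?U *v v k)) / a k"
  have cost_t: "trace (W ** matrix_inv (real t *\<^sub>R Le + X)) = ?ne * (1 / real t) + ?nv / ?q" if "t \<in> {1..T}" for t
  proof -
    have "matrix_inv (real t *\<^sub>R Le + X) = V ** K t ** V"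
      using that by (intro matrix_inv_unique inv) simp
    then have "trace (W ** matrix_inv (real t *\<^sub>R Le + X)) = trace (W ** V ** K t ** V)"
      by (simp add: matrix_mul_assoc)
    also have "\<dots> = trace (V ** (W ** V ** K t))" by (rule trace_mul_sym)
    also have "\<dots> = trace (?U ** K t)" by (simp add: W_V_def matrix_mul_assoc)
    also have "\<dots> = (\<Sum>k=1..r. 1 / (real t * ev k) * (e k \<bullet> (?U *v e k)))
        + (\<Sum>k=1..m. 1 / (?q * a k) * (v k \<bullet> (?U *v v k)))"
      unfolding K_def by (simp only: matrix_add_ldistrib trace_add trace_mult_outer_sum)
    also have "\<dots> = ?ne * (1 / real t) + ?nv / ?q"
      by (simp add: sum_distrib_right sum_divide_distrib field_simps)
    finally show ?thesis .
  qed
  have "trace (matrix_inv Z ** X) = trace Y"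
  proof -
    have "trace (matrix_inv Z ** X) = trace (V ** (V ** ?I) ** Y ** ?I)"
      by (simp add: X_def VV[symmetric] matrix_mul_assoc)
    also have "\<dots> = trace (?I ** (V ** Y))"
      unfolding pos_def_inverse[OF V] by (subst trace_mul_sym) simp
    finally show ?thesis by (simp add: matrix_mul_assoc pos_def_inverse[OF V])
  qed
  also have "\<dots> = ?q * (\<Sum>k=1..m. a k)"
    using trace_mult_outer_sum[of "mat 1" "\<lambda>k. ?q * a k" v "{1..m}"] orthonormal_family_inner[OF ov]
    by (simp add: Y_def sum_distrib_left)
  finally have pay: "trace (matrix_inv Z ** X) = ?q * (\<Sum>k=1..m. a k)" .
  have "static_cost W Z Le T X = (\<Sum>t=1..T. ?ne * (1 / real t) + ?nv / ?q) + ?q * (\<Sum>k=1..m. a k)"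
    unfolding static_cost_def pay using cost_t by simp
  also have "\<dots> = (\<Sum>t=1..T. 1 / real t) * ?ne + real T * (?nv / ?q) + ?q * (\<Sum>k=1..m. a k)"
  proof -
    have "(\<Sum>t=1..T. x * (1 / real t) + y) = (\<Sum>t=1..T. 1 / real t) * x + real T * y" for x y :: real
      by (simp add: sum.distrib sum_distrib_right)
    then show ?thesis by simp
  qed
  also have "real T * (?nv / ?q) = ?nv * ?q"
    using T by (simp add: field_simps real_sqrt_mult_self)
  finally have "static_cost W Z Le T X = chi_const ?U m v * ?q + nu_seq ?U r ev e T"
    by (simp add: chi_const_def nu_seq_def a_def algebra_simps)
  with feas show ?thesis by blast
qed

text \<open>Singularity makes the null basis nonempty, and each of its vectors contributes a positive amount
  because \<open>W\<^sub>V\<close> and its square root are positive definite.\<close>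

lemma singular_delta_chi_pos:
  assumes W: "pos_def W" and V: "pos_def V" and sing: "\<not> invertible Le"
    and v: "orthonormal_null_basis (S_V V Le) m v"
  shows "0 < delta_const (W_V V W) m v" and "0 < chi_const (W_V V W) m v"
proof -
  have U: "pos_def (W_V V W)"
    unfolding W_V_def by (rule pos_def_symmetric_congruence[OF W V])
  have ov: "orthonormal_family m v" using v by (simp add: orthonormal_null_basis_def)
  have "\<not> (\<forall>x. Le *v x = 0 \<longrightarrow> x = 0)"
    using sing matrix_left_invertible_ker[of Le] matrix_left_right_inverse by (auto simp: invertible_def)
  then obtain x where x: "Le *v x = 0" "x \<noteq> 0" by blast
  let ?y = "matrix_inv V *v x"
  have "S_V V Le *v ?y = V *v (Le *v (V *v ?y))"
    by (simp only: S_V_def matrix_vector_mul_assoc matrix_mul_assoc)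
  also have "\<dots> = 0" by (simp add: pos_def_inverse_mult[OF V] x)
  finally have "?y \<in> span (v ` {1..m})" using v by (simp add: orthonormal_null_basis_def)
  moreover have "?y \<noteq> 0" using pos_def_inverse_mult(1)[OF V, of x] x(2) by auto
  ultimately have "span (v ` {1..m}) \<noteq> {0}" by blast
  then have m: "{1..m} \<noteq> {}" by (rule contrapos_nn) (simp only: image_empty span_empty)
  have nz: "v k \<noteq> 0" if "k \<in> {1..m}" for k
    using orthonormal_family_inner[OF ov that that] by auto
  have pos: "0 < v k \<bullet> (psd_sqrt (W_V V W) *v v k)" "0 < v k \<bullet> (W_V V W *v v k)" if "k \<in> {1..m}" for k
    using nz[OF that] U pos_def_psd_sqrt[OF U] by (simp_all add: pos_def_def)
  show "0 < delta_const (W_V V W) m v"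
    unfolding delta_const_def using pos m by (intro mult_pos_pos sum_pos) auto
  show "0 < chi_const (W_V V W) m v"
    unfolding chi_const_def using pos m by (intro add_pos_pos sum_pos divide_pos_pos) auto
qed

text \<open>The harmonic numbers differ from the logarithm by a convergent sequence, and the logarithm is \<open>o(\<surd>T)\<close>.\<close>

lemma harmonic_smallo_sqrt: "(\<lambda>T. \<Sum>t=1..T. 1 / real t) \<in> o(\<lambda>T. sqrt (real T))"
proof -
  have "(\<lambda>n. harm n - ln (real n)) \<in> O(\<lambda>_. 1 :: real)"
    using euler_mascheroni_LIMSEQ by (intro bigoI_tendsto[where c = euler_mascheroni]) simp_all
  also have "(\<lambda>_. 1 :: real) \<in> o(\<lambda>n. sqrt (real n))" by real_asymp
  finally have "(\<lambda>n. harm n - ln (real n)) \<in> o(\<lambda>n. sqrt (real n))" .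
  moreover have "(\<lambda>n. ln (real n)) \<in> o(\<lambda>n. sqrt (real n))" by real_asymp
  ultimately have "(\<lambda>n. (harm n - ln (real n)) + ln (real n)) \<in> o(\<lambda>n. sqrt (real n))"
    by (rule sum_in_smallo)
  then show ?thesis by (simp add: harm_def inverse_eq_divide)
qed

lemma nu_seq_smallo: "nu_seq U r ev e \<in> o(\<lambda>T. sqrt (real T))"
  unfolding nu_seq_def[abs_def] using harmonic_smallo_sqrt by simp

section \<open>The optimal excitation\<close>

theorem theorem3:
  fixes W Z Le :: "real^'n^'n" and T :: nat
  assumes "T \<ge> 1"
    and "pos_def W"
    and "pos_def Z"
    and "pos_semidef Le"
  shows
    "(\<exists>L. optimal W Z Le T L \<and>
        (\<forall>L'. optimal W Z Le T L' \<longrightarrow> (\<forall>t\<in>{1..T}. L' t = L t)))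
     \<and> (\<forall>L. optimal W Z Le T L \<longrightarrow> solution1 T L \<or> solution2 T L)
     \<and> (pos_def Le \<and> c_const W Z Le T \<ge> 1 \<longrightarrow>
          (\<forall>L. solution1 T L \<longrightarrow> optimal W Z Le T L) \<and>
          regret W Z Le T = trace (matrix_inv Le ** W) * (\<Sum>t=1..T. 1 / real t))
     \<and> (pos_def Le \<and> c_const W Z Le T < 1 \<longrightarrow>
          (\<exists>L. solution2 T L \<and> optimal W Z Le T L) \<and>
          (2 - c_const W Z Le T) * c_const W Z Le T * trace (matrix_inv Le ** W)
              * (\<Sum>t=1..T. 1 / real t) \<le> regret W Z Le T \<and>
          regret W Z Le T \<le> trace (matrix_inv Le ** W) * (\<Sum>t=1..T. 1 / real t))
     \<and> (\<not> invertible Le \<longrightarrow>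
          (\<exists>L. solution2 T L \<and> optimal W Z Le T L) \<and>
          (let V = pd_sqrt (matrix_inv Z); SV = S_V V Le; WV = W_V V W in
            \<forall>m v r ev e. orthonormal_null_basis SV m v \<and> eigendecomposition SV r ev e \<longrightarrow>
              delta_const WV m v * sqrt (real T) \<le> regret W Z Le T \<and>
              regret W Z Le T \<le> chi_const WV m v * sqrt (real T) + nu_seq WV r ev e T \<and>
              0 < delta_const WV m v \<and> 0 < chi_const WV m v \<and>
              nu_seq WV r ev e \<in> o(\<lambda>T. sqrt (real T))))"
proof -
  note T = assms(1) and W = assms(2) and Z = assms(3) and Le = assms(4)
  note opt_iff = optimal_iff_static_optimal[OF W Le T, of Z]
  obtain X where X: "static_optimal W Z Le T X" using static_optimal_exists[OF W Z Le T] by blast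
  then have feasX: "static_feasible Le X"
    and minX: "\<And>Y. static_feasible Le Y \<Longrightarrow> static_cost W Z Le T X \<le> static_cost W Z Le T Y"
    by (simp_all add: static_optimal_def)
  have regret: "regret W Z Le T = static_cost W Z Le T X" by (rule regret_eq_static_cost[OF W Le T X])
  define L where "L = (\<lambda>t::nat. if t = 1 then X else 0)"
  have optL: "optimal W Z Le T L" unfolding opt_iff using X by (simp add: L_def)
  have sol2: "\<exists>L. solution2 T L \<and> optimal W Z Le T L" if "X \<noteq> 0"
    using that optL by (intro exI[of _ L]) (simp add: solution2_def L_def)
  have unique: "\<forall>t\<in>{1..T}. L' t = L t" if "optimal W Z Le T L'" for L'
  proof
    fix t assume "t \<in> {1..T}"
    then show "L' t = L t"
      using that static_optimal_unique[OF W Le T X, of "L' 1"] unfolding opt_iff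
      by (cases "t = 1") (auto simp: L_def)
  qed
  have types: "solution1 T L' \<or> solution2 T L'" if "optimal W Z Le T L'" for L'
  proof -
    have "L' t = 0" if "t \<in> {1..T}" "L' 1 = 0" for t
      using that \<open>optimal W Z Le T L'\<close> unfolding opt_iff by (cases "t = 1") auto
    then show ?thesis using that unfolding opt_iff solution1_def solution2_def by blast
  qed
  let ?c = "c_const W Z Le T"
  let ?F = "trace (matrix_inv Le ** W) * (\<Sum>t=1..T. 1 / real t)"
  let ?\<mu> = "lambda_max (Z ** (matrix_inv Le ** W ** matrix_inv Le)) * (\<Sum>t=1..T. 1 / (real t)\<^sup>2)"
  have c: "?c = inverse ?\<mu>" by (simp add: c_const_def matrix_mul_assoc)
  have \<mu>: "0 < ?\<mu>" if "pos_def Le"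
    using T lambda_max_pencil(1)[OF Z pos_def_symmetric_congruence[OF W pos_def_matrix_inv[OF that]]] by (intro mult_pos_pos sum_pos) auto
  have zero: "static_feasible Le 0" if "pos_def Le"
    using that by (simp add: static_feasible_def pos_semidef_zero)
  have case1: "(\<forall>L. solution1 T L \<longrightarrow> optimal W Z Le T L) \<and> regret W Z Le T = ?F"
    if pd: "pos_def Le" and c1: "1 \<le> ?c"
  proof -
    have "?\<mu> \<le> 1" using c1 unfolding c one_le_inverse_iff by blast
    then have "?F \<le> static_cost W Z Le T Y" if "static_feasible Le Y" for Y
      using static_cost_ge_scaled[OF W Z pd that, of 1 T] by simp
    then have opt0: "static_optimal W Z Le T 0"
      using zero[OF pd] by (simp add: static_optimal_def static_cost_zero[OF pd])
    have "optimal W Z Le T L" if "solution1 T L" for L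
    proof -
      have "\<forall>t\<in>{2..T}. L t = 0" "L 1 = 0" using that T by (auto simp: solution1_def)
      then show ?thesis unfolding opt_iff using opt0 by simp
    qed
    then show ?thesis
      using regret_eq_static_cost[OF W Le T opt0] static_cost_zero[OF pd, of W Z T] by simp
  qed
  have case2: "(\<exists>L. solution2 T L \<and> optimal W Z Le T L) \<and>
      (2 - ?c) * ?c * trace (matrix_inv Le ** W) * (\<Sum>t=1..T. 1 / real t) \<le> regret W Z Le T \<and>
      regret W Z Le T \<le> ?F"
    if pd: "pos_def Le" and c1: "?c < 1"
  proof (intro conjI)
    have "1 < ?\<mu>" using c1 \<mu>[OF pd] unfolding c inverse_less_1_iff by linarith
    then have "X \<noteq> 0" using static_optimal_zero_imp[OF W Z pd, of T] X by fastforce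
    then show "\<exists>L. solution2 T L \<and> optimal W Z Le T L" by (rule sol2)
    have "(inverse x)\<^sup>2 * x = inverse x" if "0 < x" for x :: real
      using that by (simp add: power2_eq_square)
    from this[OF \<mu>[OF pd]] have "?c\<^sup>2 * ?\<mu> = ?c" unfolding c .
    then have "?c\<^sup>2 * ?\<mu> \<le> 1" using c1 by simp
    then show "(2 - ?c) * ?c * trace (matrix_inv Le ** W) * (\<Sum>t=1..T. 1 / real t) \<le> regret W Z Le T"
      unfolding regret by (rule static_cost_ge_scaled[OF W Z pd feasX])
    show "regret W Z Le T \<le> ?F"
      unfolding regret static_cost_zero[OF pd, of W Z T, symmetric] by (rule minX[OF zero[OF pd]])
  qed
  have case3: "(\<exists>L. solution2 T L \<and> optimal W Z Le T L) \<and>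
      (let V = pd_sqrt (matrix_inv Z); SV = S_V V Le; WV = W_V V W in
        \<forall>m v r ev e. orthonormal_null_basis SV m v \<and> eigendecomposition SV r ev e \<longrightarrow>
          delta_const WV m v * sqrt (real T) \<le> regret W Z Le T \<and>
          regret W Z Le T \<le> chi_const WV m v * sqrt (real T) + nu_seq WV r ev e T \<and>
          0 < delta_const WV m v \<and> 0 < chi_const WV m v \<and>
          nu_seq WV r ev e \<in> o(\<lambda>T. sqrt (real T)))"
    if sing: "\<not> invertible Le"
    unfolding Let_def
  proof (intro conjI allI impI; (elim conjE)?)
    have "X \<noteq> 0"
    proof
      assume "X = 0"
      then have "pos_def Le" using feasX by (simp add: static_feasible_def)
      then show False using sing pos_def_inverse[of Le] by (auto simp: invertible_def)
    qed
    then show "\<exists>L. solution2 T L \<and> optimal W Z Le T L" by (rule sol2)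
    let ?V = "pd_sqrt (matrix_inv Z)"
    have V: "pos_def ?V" by (rule pd_sqrt_works(1)[OF pos_def_matrix_inv[OF Z]])
    fix m v r ev e
    assume v: "orthonormal_null_basis (S_V ?V Le) m v" and e: "eigendecomposition (S_V ?V Le) r ev e"
    show "delta_const (W_V ?V W) m v * sqrt (real T) \<le> regret W Z Le T"
      unfolding regret by (rule static_cost_ge_delta[OF W Z Le T feasX v])
    show "regret W Z Le T \<le> chi_const (W_V ?V W) m v * sqrt (real T) + nu_seq (W_V ?V W) r ev e T"
    proof -
      obtain Y where Y: "static_feasible Le Y" and "static_cost W Z Le T Y =
          chi_const (W_V ?V W) m v * sqrt (real T) + nu_seq (W_V ?V W) r ev e T"
        using static_cost_le_chi_nu[OF W Z Le T v e] by blast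
      then show ?thesis unfolding regret using minX[OF Y] by simp
    qed
    show "0 < delta_const (W_V ?V W) m v" "0 < chi_const (W_V ?V W) m v"
      using singular_delta_chi_pos[OF W V sing v] by blast+
    show "nu_seq (W_V ?V W) r ev e \<in> o(\<lambda>T. sqrt (real T))" by (rule nu_seq_smallo)
  qed
  show ?thesis
    using optL unique types case1 case2 case3 by blast
qed

end
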